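(* Let $\phi$ and $E$ be entire functions such that $E$ belongs to the Hermite-Biehler class $\mathcal{H}B$, and let $(t_n)_{n\in\mathbb{N}}$ be the sequence of (real, distinct) zeros of $A(z)=\frac{E(z)+E^{\#}(z)}{2}$, assumed infinite and with $E(t_n)\neq 0$ for all $n$. Let the composition operator $C_\phi$, $C_\phi f=f\circ\phi$, be bounded on $H(E)$. Define $$Q_n:=\begin{cases}\dfrac{|E(\phi(t_n))|^2-|E(\overline{\phi(t_n)})|^2}{-4i\,\Im(\phi(t_n))\,E(t_n)\,\Re(E'(t_n))} & \text{if } \phi(t_n)\notin\mathbb{R},\\[3mm] \dfrac{-i\,\Im\!\left(E'(\phi(t_n))\,\overline{E(\phi(t_n))}\right)}{E(t_n)\,\Re(E'(t_n))} & \text{if } \phi(t_n)\in\mathbb{R}.\end{cases}$$ If there is a finite constant $d>0$ such that $d\le\limsup_{n\to\infty}Q_n$, then $C_\phi$ is not compact on $H(E)$.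
   Context: $\mathbb{C}_+$ is the open upper half-plane; for an entire function $f$, $f^{\#}(z):=\overline{f(\bar z)}$. $H^2(\mathbb{C}_+)$ is the Hardy Hilbert space on $\mathbb{C}_+$. An entire function $E$ is in the Hermite-Biehler class $\mathcal{H}B$ if $|E(\bar z)|<|E(z)|$ for all $z\in\mathbb{C}_+$. For $E\in\mathcal{H}B$ the de Branges space is $$H(E):=\left\{f \text{ entire}: \tfrac{f}{E},\ \tfrac{f^{\#}}{E}\in H^2(\mathbb{C}_+)\right\},\qquad \langle f,g\rangle_{H(E)}=\int_{-\infty}^{\infty}\frac{f(t)\overline{g(t)}}{|E(t)|^2}\,dt .$$ Saying that $C_\phi$ is bounded on $H(E)$ means that $f\circ\phi\in H(E)$ for every $f\in H(E)$ and $f\mapsto f\circ\phi$ is a bounded linear operator on $H(E)$. Since $A(t_n)=0$, $E(t_n)$ is purely imaginary, so each $Q_n$ is a real number. *)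

theory Defs
  imports "HOL-Complex_Analysis.Complex_Analysis"
begin

definition upper_half_plane :: "complex set" where
  "upper_half_plane = {z. Im z > 0}"

definition sharp :: "(complex \<Rightarrow> complex) \<Rightarrow> complex \<Rightarrow> complex" where
  "sharp f z = cnj (f (cnj z))"

text \<open>Only the values of \<open>f\<close> on the open upper half-plane matter here, so a total function
  may stand for its restriction.\<close>

definition hardy_H2 :: "(complex \<Rightarrow> complex) set" where
  "hardy_H2 = {f. f holomorphic_on upper_half_plane \<and>
     (SUP y\<in>{0<..}. \<integral>\<^sup>+x. ennreal ((cmod (f (Complex x y)))\<^sup>2) \<partial>lborel) < \<infinity>}"

definition hermite_biehler :: "(complex \<Rightarrow> complex) set" where
  "hermite_biehler = {E. E holomorphic_on UNIV \<and>
     (\<forall>z\<in>upper_half_plane. cmod (E (cnj z)) < cmod (E z))}"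

definition dB_space :: "(complex \<Rightarrow> complex) \<Rightarrow> (complex \<Rightarrow> complex) set" where
  "dB_space E = {f. f holomorphic_on UNIV \<and>
     (\<lambda>z. f z / E z) \<in> hardy_H2 \<and> (\<lambda>z. sharp f z / E z) \<in> hardy_H2}"

text \<open>For \<open>f\<close> and \<open>g\<close> in the de Branges space the integrand is integrable: \<open>f / E\<close> and
  \<open>g / E\<close> have square-integrable boundary values. It is undefined (set to \<open>0\<close> by
  division) only on the null set of real zeros of \<open>E\<close>.\<close>

definition dB_inner ::
    "(complex \<Rightarrow> complex) \<Rightarrow> (complex \<Rightarrow> complex) \<Rightarrow> (complex \<Rightarrow> complex) \<Rightarrow> complex" where
  "dB_inner E f g =
     (LINT t|lborel. f (of_real t) * cnj (g (of_real t)) / of_real ((cmod (E (of_real t)))\<^sup>2))"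

definition dB_norm :: "(complex \<Rightarrow> complex) \<Rightarrow> (complex \<Rightarrow> complex) \<Rightarrow> real" where
  "dB_norm E f = sqrt (Re (dB_inner E f f))"

definition dB_linear_operator ::
    "(complex \<Rightarrow> complex) \<Rightarrow> ((complex \<Rightarrow> complex) \<Rightarrow> complex \<Rightarrow> complex) \<Rightarrow> bool" where
  "dB_linear_operator E T \<longleftrightarrow>
     (\<forall>f\<in>dB_space E. T f \<in> dB_space E) \<and>
     (\<forall>f\<in>dB_space E. \<forall>g\<in>dB_space E. \<forall>a b. \<forall>z.
        T (\<lambda>w. a * f w + b * g w) z = a * T f z + b * T g z)"

definition dB_bounded_operator ::
    "(complex \<Rightarrow> complex) \<Rightarrow> ((complex \<Rightarrow> complex) \<Rightarrow> complex \<Rightarrow> complex) \<Rightarrow> bool" where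
  "dB_bounded_operator E T \<longleftrightarrow>
     dB_linear_operator E T \<and>
     (\<exists>M. \<forall>f\<in>dB_space E. dB_norm E (T f) \<le> M * dB_norm E f)"

text \<open>Compactness in sequential form: every norm-bounded sequence has a subsequence whose
  image converges in norm to an element of the space.\<close>

definition dB_compact_operator ::
    "(complex \<Rightarrow> complex) \<Rightarrow> ((complex \<Rightarrow> complex) \<Rightarrow> complex \<Rightarrow> complex) \<Rightarrow> bool" where
  "dB_compact_operator E T \<longleftrightarrow>
     dB_linear_operator E T \<and>
     (\<forall>f :: nat \<Rightarrow> complex \<Rightarrow> complex.
        (\<forall>n. f n \<in> dB_space E) \<and> (\<exists>M. \<forall>n. dB_norm E (f n) \<le> M) \<longrightarrow>
        (\<exists>r g. strict_mono (r :: nat \<Rightarrow> nat) \<and> g \<in> dB_space E \<and>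
           (\<lambda>n. dB_norm E (\<lambda>z. T (f (r n)) z - g z)) \<longlonglongrightarrow> 0))"

definition composition_operator ::
    "(complex \<Rightarrow> complex) \<Rightarrow> (complex \<Rightarrow> complex) \<Rightarrow> complex \<Rightarrow> complex" where
  "composition_operator \<phi> f = f \<circ> \<phi>"

definition A_part :: "(complex \<Rightarrow> complex) \<Rightarrow> complex \<Rightarrow> complex" where
  "A_part E z = (E z + sharp E z) / 2"

text \<open>The quotient at a real point \<open>t\<close>. At a zero of \<open>A_part E\<close> the number \<open>E t\<close> is purely
  imaginary, so there the value is real although the formula is complex.\<close>

definition Q_quotient :: "(complex \<Rightarrow> complex) \<Rightarrow> (complex \<Rightarrow> complex) \<Rightarrow> real \<Rightarrow> complex" where
  "Q_quotient E \<phi> t =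
     (let w = \<phi> (of_real t);
          Et = E (of_real t);
          dEt = complex_of_real (Re (deriv E (of_real t)))
      in if w \<notin> \<real>
         then complex_of_real ((cmod (E w))\<^sup>2 - (cmod (E (cnj w)))\<^sup>2)
                / (- 4 * \<i> * complex_of_real (Im w) * Et * dEt)
         else - \<i> * complex_of_real (Im (deriv E w * cnj (E w))) / (Et * dEt))"

end

theory Submission
  imports Defs "HOL-Probability.Sinc_Integral"
begin

text \<open>Write \<open>K\<^sub>w\<close> for the reproducing kernel of \<open>H(E)\<close> at \<open>w\<close>. For a zero \<open>t\<close> of \<open>A = (E + E\<^sup>#) / 2\<close>, inserting
\<open>cnj (E t) = - E t\<close> into the formula for \<open>K\<^sub>t(t)\<close> turns the quotient of the statement into
\<open>Q = K\<^sub>w(w) / K\<^sub>t(t) = (norm K\<^sub>w / norm K\<^sub>t)\<^sup>2\<close> with \<open>w = \<phi> t\<close> (lemma \<open>Q_quotient_eq_kernel_ratio\<close>). Abstractly, the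
adjoint of the composition operator sends \<open>K\<^sub>t\<close> to \<open>K\<^sub>w\<close>, the normalised kernels at the zeros of \<open>A\<close> are
orthonormal, hence weakly null, and a compact adjoint would send them to a norm-null sequence.

The proof below uses this without the adjoint. Along a subsequence \<open>Q > d / 2\<close>; there let \<open>f\<^sub>n\<close> be the
normalised kernel at \<open>w\<^sub>n = \<phi> t\<^sub>n\<close>. Then \<open>(f\<^sub>n \<circ> \<phi>)(t\<^sub>n) / norm K\<close>, with \<open>K\<close> the kernel at \<open>t\<^sub>n\<close>, is the square
root of \<open>Q\<close>, so it is at least \<open>sqrt (d / 2)\<close>. If a subsequence of the images \<open>f\<^sub>n \<circ> \<phi>\<close> converged to \<open>g\<close>, then along it
\<open>f\<^sub>n \<circ> \<phi> - g\<close> would contribute at most its norm to this number, and \<open>g\<close> would contribute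
\<open>g(t\<^sub>n) / norm K\<close>. Both tend to \<open>0\<close>: the squares of the latter form a convergent series by Bessel's
inequality (\<open>bessel_inequality_zeros\<close>). This is a contradiction.

The analytic substance is the reproducing property (\<open>dB_kernel_reproducing\<close>). On the real line \<open>cnj K\<^sub>w / \<bar>E\<bar>\<^sup>2\<close>
is a combination of \<open>1 / (E (x - w))\<close> and \<open>1 / (E\<^sup># (x - w))\<close>, so the inner product of \<open>f\<close> with \<open>K\<^sub>w\<close> is a combination
of Cauchy integrals of \<open>f / E\<close> and of the conjugate of \<open>f\<^sup># / E\<close>, both with Hardy class numerators. Two facts
evaluate them. First, \<open>\<integral> F(x) / (x - p) dx = 0\<close> for \<open>F\<close> in the Hardy class and \<open>p\<close> in the lower half-plane
(\<open>integral_mult_kernel_eq_0\<close>): this follows by shifting horizontal contours upwards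
(\<open>horizontal_line_integral_eq\<close>) and passing to boundary values (\<open>tendsto_integral_of_L2_bounded\<close>). Second, a zero of
a numerator can be divided out within the Hardy class (\<open>quotient_at_hardy\<close>); this handles the
singularity at \<open>w\<close> in the same way in the upper half-plane and on the real line, where a principal value
would otherwise be needed. For \<open>w\<close> in the lower half-plane only the norm of \<open>K\<^sub>w\<close> is needed, and the
symmetry \<open>f \<mapsto> f\<^sup>#\<close> reduces it to the upper half-plane.\<close>

section \<open>Integrals over the real line\<close>

lemma has_bochner_integral_inverse_norm_square:
  assumes "Im p \<noteq> 0"
  shows "has_bochner_integral lborel (\<lambda>x. 1 / (cmod (of_real x - p))\<^sup>2) (pi / \<bar>Im p\<bar>)"
proof -
  define v where "v = \<bar>Im p\<bar>"
  have v: "v > 0" using assms by (simp add: v_def)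
  have base: "has_bochner_integral lborel (\<lambda>x::real. inverse (1 + x\<^sup>2)) pi"
    using integrable_inverse_1_plus_square LBINT_inverse_1_plus_square
    by (simp add: has_bochner_integral_iff set_integrable_def interval_lebesgue_integral_def
        set_lebesgue_integral_def einterval_eq_UNIV)
  have *: "inverse (1 + ((x - Re p) / v)\<^sup>2) = v\<^sup>2 * (1 / (cmod (of_real x - p))\<^sup>2)" for x
  proof -
    have n: "(cmod (of_real x - p))\<^sup>2 = (x - Re p)\<^sup>2 + v\<^sup>2"
      by (simp add: cmod_power2 v_def)
    show ?thesis unfolding n using v
      by (simp add: power_divide inverse_eq_divide divide_simps)
  qed
  have "has_bochner_integral lborel (\<lambda>x. inverse (1 + (- (Re p / v) + (1 / v) * x)\<^sup>2)) (pi /\<^sub>R \<bar>1 / v\<bar>)"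
    using v by (subst lborel_has_bochner_integral_real_affine_iff[symmetric]) (use base in auto)
  moreover have "(\<lambda>x. inverse (1 + (- (Re p / v) + (1 / v) * x)\<^sup>2))
      = (\<lambda>x. v\<^sup>2 * (1 / (cmod (of_real x - p))\<^sup>2))"
    by (subst *[symmetric]) (simp add: diff_divide_distrib)
  ultimately have "has_bochner_integral lborel (\<lambda>x. v\<^sup>2 * (1 / (cmod (of_real x - p))\<^sup>2)) (pi * v)"
    using v by (simp add: mult.commute)
  then have "has_bochner_integral lborel (\<lambda>x. (1 / v\<^sup>2) * (v\<^sup>2 * (1 / (cmod (of_real x - p))\<^sup>2)))
      ((1 / v\<^sup>2) * (pi * v))"
    by (rule has_bochner_integral_mult_right)
  then show ?thesis using v by (simp add: power2_eq_square v_def[symmetric])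
qed

text \<open>A nonzero limit would bound the modulus from below on a half-line, which has infinite measure.\<close>

lemma integrable_limit_at_top_eq_0:
  fixes f :: "real \<Rightarrow> complex"
  assumes f: "integrable lborel f" and lim: "(f \<longlongrightarrow> l) at_top"
  shows "l = 0"
proof (rule ccontr)
  assume "l \<noteq> 0"
  define c where "c = cmod l / 2"
  have c: "c > 0" using \<open>l \<noteq> 0\<close> by (simp add: c_def)
  have "eventually (\<lambda>x. c < cmod (f x)) at_top"
    using tendsto_norm[OF lim] \<open>l \<noteq> 0\<close> by (intro order_tendstoD(1)) (auto simp: c_def)
  then obtain R where R: "\<And>x. x \<ge> R \<Longrightarrow> c < cmod (f x)"
    by (auto simp: eventually_at_top_linorder)
  have fin: "(\<integral>\<^sup>+x. ennreal (cmod (f x)) \<partial>lborel) < \<infinity>"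
    using f by (simp add: integrable_iff_bounded)
  have "ennreal (c * real n) \<le> (\<integral>\<^sup>+x. ennreal (cmod (f x)) \<partial>lborel)" for n
  proof -
    have "ennreal (c * real n) = (\<integral>\<^sup>+x. ennreal c * indicator {R..R + real n} x \<partial>lborel)"
      using c by (subst nn_integral_cmult_indicator) (auto simp: ennreal_mult)
    also have "\<dots> \<le> (\<integral>\<^sup>+x. ennreal (cmod (f x)) \<partial>lborel)"
      by (intro nn_integral_mono) (auto simp: indicator_def intro!: ennreal_leI less_imp_le[OF R])
    finally show ?thesis .
  qed
  moreover obtain M where M: "M \<ge> 0" "(\<integral>\<^sup>+x. ennreal (cmod (f x)) \<partial>lborel) = ennreal M"
    using fin by (metis ennreal_cases infinity_ennreal_def less_irrefl)
  ultimately have b: "c * real n \<le> M" for n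
    by (metis ennreal_le_iff)
  obtain n where "M / c < real n" using reals_Archimedean2 by blast
  then show False using b[of n] c by (simp add: field_simps)
qed

lemma tendsto_integral_symmetric:
  fixes f :: "real \<Rightarrow> complex"
  assumes f: "integrable lborel f"
  shows "((\<lambda>R. LINT x|lborel. indicator {-R..R} x *\<^sub>R f x) \<longlongrightarrow> integral\<^sup>L lborel f) at_top"
proof (rule integral_dominated_convergence_at_top)
  show "integrable lborel (\<lambda>x. cmod (f x))" using f by simp
  show "AE x in lborel. ((\<lambda>i. indicator {- i..i} x *\<^sub>R f x) \<longlongrightarrow> f x) at_top"
  proof (intro AE_I2 tendsto_eventually)
    fix x :: real
    show "\<forall>\<^sub>F i in at_top. indicator {- i..i} x *\<^sub>R f x = f x"
      using eventually_ge_at_top[of "\<bar>x\<bar>"] by eventually_elim (auto simp: indicator_def)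
  qed
qed (use f in \<open>auto simp: indicator_def\<close>)

section \<open>Shifting horizontal contours\<close>

lemma upper_half_plane_props: "open upper_half_plane" "convex upper_half_plane"
  by (simp_all add: upper_half_plane_def open_halfspace_Im_gt convex_halfspace_Im_gt)

lemma Complex_measurable [measurable]:
  "(\<lambda>x. Complex x y) \<in> borel_measurable borel"
  "(\<lambda>p. Complex (fst p) (snd p)) \<in> borel_measurable (borel \<Otimes>\<^sub>M borel)"
proof -
  show "(\<lambda>x. Complex x y) \<in> borel_measurable borel"
    by (intro borel_measurable_continuous_onI) (simp add: Complex_eq continuous_intros)
  show "(\<lambda>p. Complex (fst p) (snd p)) \<in> borel_measurable (borel \<Otimes>\<^sub>M borel)"
    unfolding borel_prod by (intro borel_measurable_continuous_onI) (simp add: Complex_eq continuous_intros)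
qed

text \<open>Cutting off outside the open half-plane makes the function Borel on the whole plane, as joint
measurability in both coordinates requires.\<close>

lemma holomorphic_cutoff_measurable:
  assumes "G holomorphic_on upper_half_plane"
  shows "(\<lambda>z. indicator upper_half_plane z *\<^sub>R G z) \<in> borel_measurable borel"
  using holomorphic_on_imp_continuous_on[OF assms] upper_half_plane_props(1)
  by (intro borel_measurable_continuous_on_indicator) auto

lemma holomorphic_line_measurable:
  assumes "G holomorphic_on upper_half_plane" "y > 0"
  shows "(\<lambda>x. G (Complex x y)) \<in> borel_measurable borel"
proof -
  have "(\<lambda>x. indicator upper_half_plane (Complex x y) *\<^sub>R G (Complex x y)) \<in> borel_measurable borel"
    using measurable_compose[OF Complex_measurable(1) holomorphic_cutoff_measurable[OF assms(1)]] .
  then show ?thesis using assms(2) by (simp add: upper_half_plane_def indicator_def)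
qed

text \<open>By Cauchy's theorem the difference of the two integrals is the limit, as \<open>R\<close> grows, of the integrals over
the vertical sides at \<open>R\<close> and \<open>-R\<close> of a rectangle. No pointwise decay is known on these sides. However, the
bound on the horizontal lines says that \<open>G\<close> is integrable over the strip, so by Tonelli the side integrals
are integrable as functions of \<open>R\<close>; an integrable function that has a limit at infinity has limit \<open>0\<close>.\<close>

lemma horizontal_line_integral_eq:
  assumes G: "G holomorphic_on upper_half_plane" and ab: "0 < a" "a < b"
    and bound: "\<And>y. a \<le> y \<Longrightarrow> y \<le> b \<Longrightarrow> (\<integral>\<^sup>+x. ennreal (cmod (G (Complex x y))) \<partial>lborel) \<le> ennreal C"
  shows "(LINT x|lborel. G (Complex x a)) = (LINT x|lborel. G (Complex x b))"
proof -
  have int: "integrable lborel (\<lambda>x. G (Complex x y))" if "a \<le> y" "y \<le> b" for y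
    using bound[OF that] holomorphic_line_measurable[OF G, of y] that ab
    by (intro integrableI_bounded) (auto simp: measurable_lborel1 intro: le_less_trans)
  have "\<exists>P. \<forall>z\<in>upper_half_plane. (P has_field_derivative G z) (at z within upper_half_plane)"
    by (rule holomorphic_convex_primitive'[OF upper_half_plane_props(2,1) G]) blast
  then obtain P where "\<forall>z\<in>upper_half_plane. (P has_field_derivative G z) (at z within upper_half_plane)" ..
  note P = bspec[OF this]
  have P': "(P has_field_derivative G z) (at z)" if "Im z > 0" for z
    using P[of z] that at_within_open[OF _ upper_half_plane_props(1), of z] by (simp add: upper_half_plane_def)
  have contG: "isCont G z" if "Im z > 0" for z
    using G that upper_half_plane_props(1)
    by (metis (no_types, lifting) continuous_on_eq_continuous_at holomorphic_on_imp_continuous_on mem_Collect_eq upper_half_plane_def)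
  have dx: "((\<lambda>x. P (Complex x y)) has_vector_derivative G (Complex x y)) (at x within S)" if "y > 0" for x y S
  proof -
    have "((\<lambda>x. Complex x y) has_vector_derivative 1) (at x within S)"
      unfolding Complex_eq by (auto intro!: derivative_eq_intros)
    from field_vector_diff_chain_within[OF this has_field_derivative_at_within[OF P']]
    show ?thesis using that by (simp add: o_def)
  qed
  have dy: "((\<lambda>y. P (Complex x y)) has_vector_derivative \<i> * G (Complex x y)) (at y within S)" if "y > 0" for x y S
  proof -
    have "((\<lambda>y. Complex x y) has_vector_derivative \<i>) (at y within S)"
      unfolding Complex_eq by (auto intro!: derivative_eq_intros)
    from field_vector_diff_chain_within[OF this has_field_derivative_at_within[OF P']]
    show ?thesis using that by (simp add: o_def)
  qed
  have contx: "continuous_on S (\<lambda>x. G (Complex x y))" if "y > 0" for y S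
    using that by (intro continuous_at_imp_continuous_on ballI isCont_o2[OF _ contG]) (auto simp: Complex_eq)
  have conty: "continuous_on {a..b} (\<lambda>y. G (Complex x y))" for x
    using ab by (intro continuous_at_imp_continuous_on ballI isCont_o2[OF _ contG]) (auto simp: Complex_eq)
  \<comment> \<open>The integral over the vertical side at \<open>R\<close>, up to orientation.\<close>
  define S where "S R = P (Complex R b) - P (Complex R a)" for R
  have horiz: "(LINT x|lborel. indicator {-R..R} x *\<^sub>R G (Complex x y)) = P (Complex R y) - P (Complex (-R) y)"
    if "y > 0" "R \<ge> 0" for y R
    using that by (intro integral_FTC_Icc dx contx) auto
  have vert: "S R = (LINT y|lborel. indicator {a..b} y *\<^sub>R (\<i> * G (Complex R y)))" for R
    unfolding S_def using ab
    by (intro integral_FTC_Icc[symmetric] dy continuous_intros conty) auto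
  have lim: "((\<lambda>R. S R - S (-R)) \<longlongrightarrow> (LINT x|lborel. G (Complex x b)) - (LINT x|lborel. G (Complex x a))) at_top"
  proof -
    have "((\<lambda>R. (LINT x|lborel. indicator {-R..R} x *\<^sub>R G (Complex x b))
        - (LINT x|lborel. indicator {-R..R} x *\<^sub>R G (Complex x a)))
       \<longlongrightarrow> (LINT x|lborel. G (Complex x b)) - (LINT x|lborel. G (Complex x a))) at_top"
      using ab by (intro tendsto_diff tendsto_integral_symmetric int) auto
    moreover have "eventually (\<lambda>R. (LINT x|lborel. indicator {-R..R} x *\<^sub>R G (Complex x b))
        - (LINT x|lborel. indicator {-R..R} x *\<^sub>R G (Complex x a)) = S R - S (-R)) at_top"
      using eventually_ge_at_top[of 0] by eventually_elim (use ab in \<open>simp add: horiz S_def\<close>)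
    ultimately show ?thesis by (rule Lim_transform_eventually)
  qed
  have Smeas: "S \<in> borel_measurable borel"
  proof -
    have "continuous_on UNIV (\<lambda>x. P (Complex x y))" if "y > 0" for y
      using that has_vector_derivative_continuous[OF dx[OF that]]
      by (auto simp: continuous_on_eq_continuous_within)
    then show ?thesis unfolding S_def
      using ab by (intro borel_measurable_continuous_onI continuous_intros) auto
  qed
  \<comment> \<open>The modulus of \<open>G\<close> on the strip, as a function of two real variables for Tonelli.\<close>
  define g where "g = (\<lambda>x y. indicator {a..b} y * ennreal (cmod (indicator upper_half_plane (Complex x y) *\<^sub>R G (Complex x y))))"
  have gm: "case_prod g \<in> borel_measurable (borel \<Otimes>\<^sub>M borel)"
    unfolding g_def split_beta
    using measurable_compose[OF Complex_measurable(2) holomorphic_cutoff_measurable[OF G]]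
    by measurable
  have Sbound: "ennreal (cmod (S R)) \<le> (\<integral>\<^sup>+y. g R y \<partial>lborel)" for R
  proof -
    have i: "integrable lborel (\<lambda>y. indicator {a..b} y *\<^sub>R (\<i> * G (Complex R y)))"
      by (intro borel_integrable_compact continuous_intros conty) auto
    have "ennreal (cmod (S R)) \<le> (\<integral>\<^sup>+y. norm (indicator {a..b} y *\<^sub>R (\<i> * G (Complex R y))) \<partial>lborel)"
      unfolding vert by (rule integral_norm_bound_ennreal[OF i])
    also have "\<dots> \<le> (\<integral>\<^sup>+y. g R y \<partial>lborel)"
      unfolding g_def using ab
      by (intro nn_integral_mono) (auto simp: indicator_def upper_half_plane_def norm_mult)
    finally show ?thesis .
  qed
  have "integrable lborel S"
  proof (rule integrableI_bounded)
    show "S \<in> borel_measurable lborel" using Smeas by simp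
    have "(\<integral>\<^sup>+R. ennreal (cmod (S R)) \<partial>lborel) \<le> (\<integral>\<^sup>+R. \<integral>\<^sup>+y. g R y \<partial>lborel \<partial>lborel)"
      by (intro nn_integral_mono Sbound)
    also have "\<dots> = (\<integral>\<^sup>+y. \<integral>\<^sup>+R. g R y \<partial>lborel \<partial>lborel)"
      using gm by (intro lborel_pair.Fubini'[symmetric]) (simp add: measurable_lborel1 cong: measurable_cong_sets sets_pair_measure_cong)
    also have "\<dots> \<le> (\<integral>\<^sup>+y. indicator {a..b} y * ennreal C \<partial>lborel)"
    proof (intro nn_integral_mono)
      fix y :: real
      show "(\<integral>\<^sup>+R. g R y \<partial>lborel) \<le> indicator {a..b} y * ennreal C"
        using bound[of y] ab by (auto simp: g_def indicator_def upper_half_plane_def)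
    qed
    also have "\<dots> < \<infinity>"
      using ab by (simp add: nn_integral_multc ennreal_mult_less_top)
    finally show "(\<integral>\<^sup>+R. ennreal (cmod (S R)) \<partial>lborel) < \<infinity>" .
  qed
  moreover from lborel_integrable_real_affine[OF this, of "-1" 0]
  have "integrable lborel (\<lambda>R. S (-R))" by simp
  ultimately have "integrable lborel (\<lambda>R. S R - S (-R))" by simp
  from integrable_limit_at_top_eq_0[OF this lim] show ?thesis by simp
qed

section \<open>Hardy class functions with boundary values\<close>

lemma norm_square_sum_le: "(cmod (a + b))\<^sup>2 \<le> 2 * (cmod a)\<^sup>2 + 2 * (cmod b)\<^sup>2"
proof -
  have "(cmod (a + b))\<^sup>2 \<le> (cmod a + cmod b)\<^sup>2"
    by (intro power_mono norm_triangle_ineq) auto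
  also have "\<dots> \<le> 2 * (cmod a)\<^sup>2 + 2 * (cmod b)\<^sup>2"
    using sum_squares_bound[of "cmod a" "cmod b"] by (simp add: power2_sum)
  finally show ?thesis .
qed

text \<open>The free parameter \<open>c\<close> lets the share of one factor be made small while the other one is controlled by a
kernel integral that tends to \<open>0\<close>; it replaces the Cauchy-Schwarz inequality.\<close>

lemma mult_le_scaled_squares:
  fixes u v c :: real
  assumes "u \<ge> 0" "v \<ge> 0" "c > 0"
  shows "u * v \<le> c * u\<^sup>2 + v\<^sup>2 / c"
proof -
  have "u * v = (sqrt c * u) * (v / sqrt c)" using assms by simp
  also have "\<dots> \<le> (sqrt c * u)\<^sup>2 + (v / sqrt c)\<^sup>2"
  proof -
    have "2 * ((sqrt c * u) * (v / sqrt c)) \<le> (sqrt c * u)\<^sup>2 + (v / sqrt c)\<^sup>2"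
      using sum_squares_bound[of "sqrt c * u" "v / sqrt c"] by (simp only: mult.assoc)
    moreover have "0 \<le> (sqrt c * u) * (v / sqrt c)" using assms by simp
    ultimately show ?thesis by linarith
  qed
  finally show ?thesis using assms by (simp add: power_mult_distrib power_divide)
qed

lemma integrable_mult_square_integrable:
  fixes f g :: "real \<Rightarrow> complex"
  assumes [measurable]: "f \<in> borel_measurable borel" "g \<in> borel_measurable borel"
    and f: "integrable lborel (\<lambda>x. (cmod (f x))\<^sup>2)" and g: "integrable lborel (\<lambda>x. (cmod (g x))\<^sup>2)"
  shows "integrable lborel (\<lambda>x. f x * g x)"
proof (rule Bochner_Integration.integrable_bound)
  show "integrable lborel (\<lambda>x. (cmod (f x))\<^sup>2 + (cmod (g x))\<^sup>2)" using f g by simp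
  show "AE x in lborel. cmod (f x * g x) \<le> norm ((cmod (f x))\<^sup>2 + (cmod (g x))\<^sup>2)"
    using mult_le_scaled_squares[of "cmod (f _)" "cmod (g _)" 1] by (simp add: norm_mult)
qed simp

lemma hardy_H2_I:
  assumes "F holomorphic_on upper_half_plane"
    and "\<And>y. y > 0 \<Longrightarrow> (\<integral>\<^sup>+x. ennreal ((cmod (F (Complex x y)))\<^sup>2) \<partial>lborel) \<le> ennreal M"
  shows "F \<in> hardy_H2"
proof -
  have "(SUP y\<in>{0<..}. \<integral>\<^sup>+x. ennreal ((cmod (F (Complex x y)))\<^sup>2) \<partial>lborel) \<le> ennreal M"
    using assms(2) by (intro SUP_least) auto
  then show ?thesis using assms(1) by (auto simp: hardy_H2_def intro: le_less_trans)
qed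

lemma hardy_H2_bound:
  assumes "F \<in> hardy_H2"
  shows "\<exists>M\<ge>0. \<forall>y>0. (\<integral>\<^sup>+x. ennreal ((cmod (F (Complex x y)))\<^sup>2) \<partial>lborel) \<le> ennreal M"
proof -
  define s where "s = (SUP y\<in>{0<..}. \<integral>\<^sup>+x. ennreal ((cmod (F (Complex x y)))\<^sup>2) \<partial>lborel)"
  have "s < \<infinity>" using assms by (simp add: hardy_H2_def s_def)
  then obtain M where M: "M \<ge> 0" "s = ennreal M"
    by (metis ennreal_cases infinity_ennreal_def less_irrefl)
  have "(\<integral>\<^sup>+x. ennreal ((cmod (F (Complex x y)))\<^sup>2) \<partial>lborel) \<le> ennreal M" if "y > 0" for y
    using that unfolding M(2)[symmetric] s_def by (intro SUP_upper) auto
  with M(1) show ?thesis by blast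
qed

text \<open>The two majorants serve sums, and quotients that are estimated differently near and far from a
point.\<close>

lemma hardy_H2_dominated:
  assumes F: "F holomorphic_on upper_half_plane" and F1: "F1 \<in> hardy_H2" and F2: "F2 \<in> hardy_H2"
    and AB: "A \<ge> 0" "B \<ge> 0"
    and le: "\<And>z. z \<in> upper_half_plane \<Longrightarrow> (cmod (F z))\<^sup>2 \<le> A * (cmod (F1 z))\<^sup>2 + B * (cmod (F2 z))\<^sup>2"
  shows "F \<in> hardy_H2"
proof -
  obtain M1 where M1: "M1 \<ge> 0"
    "\<And>y. y > 0 \<Longrightarrow> (\<integral>\<^sup>+x. ennreal ((cmod (F1 (Complex x y)))\<^sup>2) \<partial>lborel) \<le> ennreal M1"
    using hardy_H2_bound[OF F1] by blast
  obtain M2 where M2: "M2 \<ge> 0"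
    "\<And>y. y > 0 \<Longrightarrow> (\<integral>\<^sup>+x. ennreal ((cmod (F2 (Complex x y)))\<^sup>2) \<partial>lborel) \<le> ennreal M2"
    using hardy_H2_bound[OF F2] by blast
  show ?thesis
  proof (rule hardy_H2_I[OF F])
    fix y :: real assume y: "y > 0"
    have [measurable]: "(\<lambda>x. F1 (Complex x y)) \<in> borel_measurable borel"
        "(\<lambda>x. F2 (Complex x y)) \<in> borel_measurable borel"
      using F1 F2 y by (auto simp: hardy_H2_def intro: holomorphic_line_measurable)
    have "(\<integral>\<^sup>+x. ennreal ((cmod (F (Complex x y)))\<^sup>2) \<partial>lborel) \<le>
      (\<integral>\<^sup>+x. ennreal A * ennreal ((cmod (F1 (Complex x y)))\<^sup>2)
        + ennreal B * ennreal ((cmod (F2 (Complex x y)))\<^sup>2) \<partial>lborel)"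
      using le y AB by (intro nn_integral_mono)
        (auto simp: upper_half_plane_def simp flip: ennreal_mult ennreal_plus intro!: ennreal_leI)
    also have "\<dots> = ennreal A * (\<integral>\<^sup>+x. ennreal ((cmod (F1 (Complex x y)))\<^sup>2) \<partial>lborel)
        + ennreal B * (\<integral>\<^sup>+x. ennreal ((cmod (F2 (Complex x y)))\<^sup>2) \<partial>lborel)"
      by (subst nn_integral_add) (auto simp: nn_integral_cmult)
    also have "\<dots> \<le> ennreal A * ennreal M1 + ennreal B * ennreal M2"
      using M1(2)[OF y] M2(2)[OF y] by (intro add_mono mult_left_mono) auto
    also have "\<dots> = ennreal (A * M1 + B * M2)"
      using AB M1(1) M2(1) by (simp add: ennreal_mult ennreal_plus)
    finally show "(\<integral>\<^sup>+x. ennreal ((cmod (F (Complex x y)))\<^sup>2) \<partial>lborel) \<le> ennreal (A * M1 + B * M2)" .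
  qed
qed

text \<open>Values off the open half-plane do not enter \<open>hardy_H2\<close>. This class fixes the values on the real line
as well: they are the limits almost everywhere along the heights \<open>1 / (n + 1)\<close>. Almost everywhere is
needed because \<open>f / E\<close> takes the value \<open>0\<close> at real zeros of \<open>E\<close>.\<close>

definition boundary_hardy :: "(complex \<Rightarrow> complex) set" where
  "boundary_hardy = {F \<in> hardy_H2. (\<lambda>x::real. F (of_real x)) \<in> borel_measurable borel \<and>
     (AE x in lborel. (\<lambda>n. F (Complex x (1 / real (Suc n)))) \<longlonglongrightarrow> F (of_real x))}"

lemma boundary_hardyD:
  assumes "F \<in> boundary_hardy"
  shows "F \<in> hardy_H2" "F holomorphic_on upper_half_plane"
    "(\<lambda>x::real. F (of_real x)) \<in> borel_measurable borel"
    "AE x in lborel. (\<lambda>n. F (Complex x (1 / real (Suc n)))) \<longlonglongrightarrow> F (of_real x)"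
  using assms by (auto simp: boundary_hardy_def hardy_H2_def)

lemma tendsto_Complex_boundary: "(\<lambda>n. Complex x (1 / real (Suc n))) \<longlonglongrightarrow> of_real x"
proof -
  have "(\<lambda>n. of_real x + \<i> * of_real (1 / real (Suc n))) \<longlonglongrightarrow> of_real x + \<i> * of_real (0::real)"
    by (intro tendsto_intros LIMSEQ_Suc lim_1_over_n)
  then show ?thesis by (simp add: Complex_eq)
qed

lemma nn_integral_inverse_norm_square:
  assumes "Im p < y"
  shows "(\<integral>\<^sup>+x. ennreal ((cmod (1 / (Complex x y - p)))\<^sup>2) \<partial>lborel) = ennreal (pi / (y - Im p))"
proof -
  have eq: "Complex x y - p = of_real x - (p - \<i> * of_real y)" for x
    by (simp add: complex_eq_iff)
  have "has_bochner_integral lborel (\<lambda>x. (cmod (1 / (Complex x y - p)))\<^sup>2) (pi / (y - Im p))"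
    using has_bochner_integral_inverse_norm_square[of "p - \<i> * of_real y"] assms
    unfolding eq by (simp add: norm_divide power_divide)
  then show ?thesis
    using nn_integral_eq_integral[of lborel "\<lambda>x. (cmod (1 / (Complex x y - p)))\<^sup>2"]
    by (simp add: has_bochner_integral_iff)
qed

lemma kernel_boundary_hardy:
  assumes "Im p < 0"
  shows "(\<lambda>z. 1 / (z - p)) \<in> boundary_hardy"
proof -
  have "(\<lambda>z. 1 / (z - p)) \<in> hardy_H2"
  proof (rule hardy_H2_I)
    show "(\<lambda>z. 1 / (z - p)) holomorphic_on upper_half_plane"
      using assms by (intro holomorphic_intros) (auto simp: upper_half_plane_def)
    fix y :: real assume "y > 0"
    then show "(\<integral>\<^sup>+x. ennreal ((cmod (1 / (Complex x y - p)))\<^sup>2) \<partial>lborel) \<le> ennreal (pi / (- Im p))"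
      using assms by (subst nn_integral_inverse_norm_square) (auto intro!: ennreal_leI frac_le simp del: divide_minus_right)
  qed
  moreover have "(\<lambda>x::real. 1 / (complex_of_real x - p)) \<in> borel_measurable borel" by simp
  moreover have "(\<lambda>n. 1 / (Complex x (1 / real (Suc n)) - p)) \<longlonglongrightarrow> 1 / (complex_of_real x - p)" for x
    using assms by (intro tendsto_intros tendsto_Complex_boundary) auto
  ultimately show ?thesis by (simp add: boundary_hardy_def)
qed

lemma boundary_hardy_lincomb:
  assumes F: "F \<in> boundary_hardy" and G: "G \<in> boundary_hardy"
  shows "(\<lambda>z. a * F z + b * G z) \<in> boundary_hardy"
proof -
  note [measurable] = boundary_hardyD(3)[OF F] boundary_hardyD(3)[OF G]
  have "(\<lambda>z. a * F z + b * G z) \<in> hardy_H2"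
  proof (rule hardy_H2_dominated[OF _ boundary_hardyD(1)[OF F] boundary_hardyD(1)[OF G]])
    show "(\<lambda>z. a * F z + b * G z) holomorphic_on upper_half_plane"
      by (intro holomorphic_intros boundary_hardyD assms)
    show "(cmod (a * F z + b * G z))\<^sup>2 \<le> (2 * (cmod a)\<^sup>2) * (cmod (F z))\<^sup>2 + (2 * (cmod b)\<^sup>2) * (cmod (G z))\<^sup>2" for z
      using norm_square_sum_le[of "a * F z" "b * G z"] by (simp add: norm_mult power_mult_distrib)
  qed auto
  moreover have "AE x in lborel. (\<lambda>n. a * F (Complex x (1 / real (Suc n))) + b * G (Complex x (1 / real (Suc n))))
      \<longlonglongrightarrow> a * F (of_real x) + b * G (of_real x)"
    using boundary_hardyD(4)[OF F] boundary_hardyD(4)[OF G]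
    by eventually_elim (intro tendsto_intros)
  ultimately show ?thesis by (simp add: boundary_hardy_def)
qed

text \<open>Fatou's lemma along the heights \<open>1 / (n + 1)\<close>.\<close>

lemma boundary_hardy_square_integrable:
  assumes F: "F \<in> boundary_hardy"
  shows "integrable lborel (\<lambda>x. (cmod (F (of_real x)))\<^sup>2)"
proof -
  note [measurable] = boundary_hardyD(3)[OF F]
  obtain M where M: "M \<ge> 0"
    "\<And>y. y > 0 \<Longrightarrow> (\<integral>\<^sup>+x. ennreal ((cmod (F (Complex x y)))\<^sup>2) \<partial>lborel) \<le> ennreal M"
    using hardy_H2_bound[OF boundary_hardyD(1)[OF F]] by blast
  define f where "f n x = ennreal ((cmod (F (Complex x (1 / real (Suc n)))))\<^sup>2)" for n x
  have fm: "f n \<in> borel_measurable lborel" for n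
    using holomorphic_line_measurable[OF boundary_hardyD(2)[OF F], of "1 / real (Suc n)"]
    unfolding f_def by measurable
  have "(\<integral>\<^sup>+x. ennreal ((cmod (F (of_real x)))\<^sup>2) \<partial>lborel) = (\<integral>\<^sup>+x. liminf (\<lambda>n. f n x) \<partial>lborel)"
  proof (rule nn_integral_cong_AE)
    show "AE x in lborel. ennreal ((cmod (F (of_real x)))\<^sup>2) = liminf (\<lambda>n. f n x)"
      using boundary_hardyD(4)[OF F]
    proof eventually_elim
      case (elim x)
      then have "(\<lambda>n. f n x) \<longlonglongrightarrow> ennreal ((cmod (F (of_real x)))\<^sup>2)"
        unfolding f_def by (intro tendsto_intros)
      from lim_imp_Liminf[OF _ this] show ?case by simp
    qed
  qed
  also have "\<dots> \<le> liminf (\<lambda>n. integral\<^sup>N lborel (f n))"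
    by (rule nn_integral_liminf[OF fm])
  also have "\<dots> \<le> liminf (\<lambda>n. ennreal M)"
    unfolding f_def by (intro Liminf_mono always_eventually allI M(2)) simp
  also have "\<dots> = ennreal M" by (simp add: Liminf_const)
  finally show ?thesis
    by (intro integrableI_bounded) (auto intro: le_less_trans)
qed

lemma boundary_hardy_mult_integrable:
  assumes "F \<in> boundary_hardy" "G \<in> boundary_hardy"
  shows "integrable lborel (\<lambda>x. F (of_real x) * G (of_real x))"
    "integrable lborel (\<lambda>x. F (of_real x) * cnj (G (of_real x)))"
proof -
  have "(\<lambda>x. cnj (G (complex_of_real x))) \<in> borel_measurable borel"
    by (rule measurable_compose[OF boundary_hardyD(3)[OF assms(2)]])
      (intro borel_measurable_continuous_onI continuous_intros)
  then show "integrable lborel (\<lambda>x. F (of_real x) * G (of_real x))"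
    "integrable lborel (\<lambda>x. F (of_real x) * cnj (G (of_real x)))"
    using assms boundary_hardy_square_integrable[OF assms(1)] boundary_hardy_square_integrable[OF assms(2)]
    by (auto intro!: integrable_mult_square_integrable boundary_hardyD(3))
qed

text \<open>A sequence that is bounded in the square norm and converges almost everywhere converges weakly; the test
functions may vary too, under a square-integrable majorant \<open>g\<close>. Where \<open>\<bar>f\<^sub>n\<bar> \<le> c g\<close>, the integrand has the
integrable majorant \<open>w = c g\<^sup>2 + \<bar>F\<bar> g\<close>; elsewhere \<open>\<bar>f\<^sub>n\<bar> g\<close> is at most \<open>\<bar>f\<^sub>n\<bar>\<^sup>2 / c\<close>, whose integral is at most \<open>M / c\<close>.
Truncating at \<open>w\<close> thus allows dominated convergence at the price of an arbitrarily small error.\<close>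

lemma tendsto_integral_of_L2_bounded:
  fixes f :: "nat \<Rightarrow> real \<Rightarrow> complex"
  assumes fm [measurable]: "\<And>n. f n \<in> borel_measurable borel" and Fm [measurable]: "F \<in> borel_measurable borel"
    and km [measurable]: "\<And>n. k n \<in> borel_measurable borel" and kmm [measurable]: "kl \<in> borel_measurable borel"
    and gm [measurable]: "g \<in> borel_measurable borel"
    and M: "\<And>n. (\<integral>\<^sup>+x. ennreal ((cmod (f n x))\<^sup>2) \<partial>lborel) \<le> ennreal M" "M \<ge> 0"
    and f: "AE x in lborel. (\<lambda>n. f n x) \<longlonglongrightarrow> F x"
    and k: "\<And>x. (\<lambda>n. k n x) \<longlonglongrightarrow> kl x" and kg: "\<And>n x. cmod (k n x) \<le> g x"
    and F2: "integrable lborel (\<lambda>x. (cmod (F x))\<^sup>2)" and g2: "integrable lborel (\<lambda>x. (g x)\<^sup>2)"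
  shows "(\<lambda>n. LINT x|lborel. f n x * k n x) \<longlonglongrightarrow> (LINT x|lborel. F x * kl x)"
proof (rule LIMSEQ_I)
  fix e :: real assume e: "e > 0"
  have g0: "g x \<ge> 0" for x using kg[of 0 x] norm_ge_zero order_trans by blast
  have klg: "cmod (kl x) \<le> g x" for x
    using k[of x] kg by (intro Lim_bounded[OF tendsto_norm[OF k[of x]]]) auto
  have f2: "integrable lborel (\<lambda>x. (cmod (f n x))\<^sup>2)" for n
    using M(1)[of n] by (intro integrableI_bounded) (auto intro: le_less_trans)
  have f2M: "(LINT x|lborel. (cmod (f n x))\<^sup>2) \<le> M" for n
    using M(1)[of n] M(2) nn_integral_eq_integral[OF f2[of n]] by simp
  have k2: "integrable lborel (\<lambda>x. (cmod (h x))\<^sup>2)"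
    if [measurable]: "h \<in> borel_measurable borel" and "\<And>x. cmod (h x) \<le> g x" for h :: "real \<Rightarrow> complex"
    by (rule Bochner_Integration.integrable_bound[OF g2]) (use that in \<open>auto intro!: power_mono\<close>)
  have int1: "integrable lborel (\<lambda>x. f n x * k n x)" for n
    by (intro integrable_mult_square_integrable f2 k2 kg) auto
  have int2: "integrable lborel (\<lambda>x. F x * kl x)"
    by (intro integrable_mult_square_integrable F2 k2 klg) auto
  have intFg: "integrable lborel (\<lambda>x. cmod (F x) * g x)"
    using integrable_norm[OF integrable_mult_square_integrable[of F "\<lambda>x. of_real (g x)"]] F2 g2 g0
    by (simp add: norm_mult)
  define c where "c = 2 * (M + 1) / e"
  have c: "c > 0" "M / c < e / 2" using e M(2) by (auto simp: c_def field_simps)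
  define D where "D n x = cmod (f n x * k n x - F x * kl x)" for n x
  define w where "w x = c * (g x)\<^sup>2 + cmod (F x) * g x" for x
  have intw: "integrable lborel w" unfolding w_def using g2 intFg by simp
  have [measurable]: "D n \<in> borel_measurable borel" "w \<in> borel_measurable borel" for n
    unfolding D_def w_def by measurable
  have w0: "w x \<ge> 0" for x using g0 c by (simp add: w_def)
  have D0: "D n x \<ge> 0" for n x by (simp add: D_def)
  have intm: "integrable lborel (\<lambda>x. min (D n x) (w x))" for n
    by (rule Bochner_Integration.integrable_bound[OF intw]) (use D0 w0 in auto)
  have "(\<lambda>n. LINT x|lborel. min (D n x) (w x)) \<longlonglongrightarrow> integral\<^sup>L lborel (\<lambda>x::real. 0::real)"
  proof (rule integral_dominated_convergence[where w = w and f = "\<lambda>x. 0" and s = "\<lambda>n x. min (D n x) (w x)" and M = lborel])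
    show "AE x in lborel. (\<lambda>n. min (D n x) (w x)) \<longlonglongrightarrow> 0"
      using f
    proof eventually_elim
      case (elim x)
      have "(\<lambda>n. f n x * k n x - F x * kl x) \<longlonglongrightarrow> F x * kl x - F x * kl x"
        by (intro tendsto_intros elim k)
      then have "(\<lambda>n. D n x) \<longlonglongrightarrow> 0"
        unfolding D_def using tendsto_norm_zero by auto
      from tendsto_min[OF this tendsto_const[of "w x"]] show ?case using w0[of x] by simp
    qed
  qed (use D0 w0 intw in auto)
  then have "eventually (\<lambda>n. (LINT x|lborel. min (D n x) (w x)) < e / 2) sequentially"
    using e by (intro order_tendstoD) auto
  then obtain N where N: "\<And>n. n \<ge> N \<Longrightarrow> (LINT x|lborel. min (D n x) (w x)) < e / 2"
    by (auto simp: eventually_sequentially)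
  have Dle: "D n x \<le> min (D n x) (w x) + (cmod (f n x))\<^sup>2 / c" for n x
  proof (cases "D n x \<le> w x")
    case True then show ?thesis using c by simp
  next
    case False
    have "D n x \<le> cmod (f n x) * cmod (k n x) + cmod (F x) * cmod (kl x)"
      unfolding D_def using norm_triangle_ineq4[of "f n x * k n x" "F x * kl x"] by (simp add: norm_mult)
    also have "\<dots> \<le> cmod (f n x) * g x + cmod (F x) * g x"
      using kg klg by (intro add_mono mult_left_mono) auto
    also have "cmod (f n x) * g x \<le> c * (g x)\<^sup>2 + (cmod (f n x))\<^sup>2 / c"
      using mult_le_scaled_squares[of "g x" "cmod (f n x)" c] g0 c by (simp add: mult.commute)
    finally show ?thesis using False by (simp add: w_def min_def)
  qed
  have "cmod ((LINT x|lborel. f n x * k n x) - (LINT x|lborel. F x * kl x)) < e" if "n \<ge> N" for n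
  proof -
    have "cmod ((LINT x|lborel. f n x * k n x) - (LINT x|lborel. F x * kl x))
        = cmod (LINT x|lborel. f n x * k n x - F x * kl x)"
      using int1 int2 by simp
    also have "\<dots> \<le> (LINT x|lborel. D n x)" unfolding D_def by (rule integral_norm_bound)
    also have "\<dots> \<le> (LINT x|lborel. min (D n x) (w x) + (cmod (f n x))\<^sup>2 / c)"
      using int1 int2 intm f2 Dle by (intro integral_mono) (auto simp: D_def)
    also have "\<dots> = (LINT x|lborel. min (D n x) (w x)) + (LINT x|lborel. (cmod (f n x))\<^sup>2) / c"
      using intm f2 by simp
    also have "\<dots> \<le> (LINT x|lborel. min (D n x) (w x)) + M / c"
      using f2M c by (intro add_left_mono divide_right_mono) auto
    also have "\<dots> < e" using N[OF that] c(2) by linarith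
    finally show ?thesis .
  qed
  then show "\<exists>N. \<forall>n\<ge>N. norm ((LINT x|lborel. f n x * k n x) - (LINT x|lborel. F x * kl x)) < e"
    by auto
qed

text \<open>Cauchy's theorem for the closed upper half-plane. Over a line at height \<open>y\<close> the integral of \<open>F / (z - p)\<close> does not
depend on \<open>y\<close>, and it tends to \<open>0\<close> as \<open>y\<close> grows because the square norm of the kernel does. Letting the height
decrease to \<open>0\<close> gives the integral of the boundary values.\<close>

lemma integral_mult_kernel_eq_0:
  assumes F: "F \<in> boundary_hardy" and p: "Im p < 0"
  shows "(LINT x|lborel. F (of_real x) / (of_real x - p)) = 0"
proof -
  note Fm [measurable] = boundary_hardyD(3)[OF F]
  obtain M where M: "M \<ge> 0"
    "\<And>y. y > 0 \<Longrightarrow> (\<integral>\<^sup>+x. ennreal ((cmod (F (Complex x y)))\<^sup>2) \<partial>lborel) \<le> ennreal M"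
    using hardy_H2_bound[OF boundary_hardyD(1)[OF F]] by blast
  define G where "G z = F z / (z - p)" for z
  have G: "G holomorphic_on upper_half_plane"
    unfolding G_def using p by (intro holomorphic_intros boundary_hardyD(2)[OF F]) (auto simp: upper_half_plane_def)
  have line: "(\<integral>\<^sup>+x. ennreal (cmod (G (Complex x y))) \<partial>lborel) \<le> ennreal (c * M + pi / ((y - Im p) * c))"
    if y: "y > 0" and c: "c > 0" for y c
  proof -
    have [measurable]: "(\<lambda>x. F (Complex x y)) \<in> borel_measurable borel"
      by (rule holomorphic_line_measurable[OF boundary_hardyD(2)[OF F] y])
    have "(\<integral>\<^sup>+x. ennreal (cmod (G (Complex x y))) \<partial>lborel)
      \<le> (\<integral>\<^sup>+x. ennreal c * ennreal ((cmod (F (Complex x y)))\<^sup>2)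
            + ennreal (1 / c) * ennreal ((cmod (1 / (Complex x y - p)))\<^sup>2) \<partial>lborel)"
    proof (rule nn_integral_mono)
      fix x
      have "cmod (G (Complex x y)) = cmod (F (Complex x y)) * cmod (1 / (Complex x y - p))"
        by (simp add: G_def norm_divide)
      also have "\<dots> \<le> c * (cmod (F (Complex x y)))\<^sup>2 + (1 / c) * (cmod (1 / (Complex x y - p)))\<^sup>2"
        using mult_le_scaled_squares[OF norm_ge_zero norm_ge_zero c] by simp
      finally show "ennreal (cmod (G (Complex x y))) \<le> ennreal c * ennreal ((cmod (F (Complex x y)))\<^sup>2)
            + ennreal (1 / c) * ennreal ((cmod (1 / (Complex x y - p)))\<^sup>2)"
        using c by (simp flip: ennreal_mult ennreal_plus)
    qed
    also have "\<dots> = ennreal c * (\<integral>\<^sup>+x. ennreal ((cmod (F (Complex x y)))\<^sup>2) \<partial>lborel)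
        + ennreal (1 / c) * (\<integral>\<^sup>+x. ennreal ((cmod (1 / (Complex x y - p)))\<^sup>2) \<partial>lborel)"
      by (subst nn_integral_add) (simp_all add: nn_integral_cmult)
    also have "\<dots> \<le> ennreal c * ennreal M + ennreal (1 / c) * ennreal (pi / (y - Im p))"
      using M(2)[OF y] y p by (intro add_mono mult_left_mono) (auto simp: nn_integral_inverse_norm_square)
    also have "\<dots> = ennreal (c * M + (1 / c) * (pi / (y - Im p)))"
    proof -
      have n: "0 \<le> c" "0 \<le> 1 / c" "0 \<le> pi / (y - Im p)" "0 \<le> c * M" "0 \<le> (1 / c) * (pi / (y - Im p))"
        using M(1) y p c by auto
      show ?thesis
        by (simp only: ennreal_plus[OF n(4,5)] ennreal_mult[OF n(1) M(1)] ennreal_mult[OF n(2,3)])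
    qed
    also have "(1 / c) * (pi / (y - Im p)) = pi / ((y - Im p) * c)" by simp
    finally show ?thesis .
  qed
  have int: "integrable lborel (\<lambda>x. G (Complex x y))" if "y > 0" for y
    using line[OF that, of 1] holomorphic_line_measurable[OF G that]
    by (intro integrableI_bounded) (auto intro: le_less_trans)
  have zero: "(LINT x|lborel. G (Complex x a)) = 0" if a: "a > 0" for a
  proof -
    have le: "cmod (LINT x|lborel. G (Complex x a)) \<le> (M + pi) / real (Suc N)" if N: "a < real (Suc N)" for N
    proof -
      \<comment> \<open>With weight \<open>c = 1 / (N + 1)\<close>, height \<open>(N + 1)\<^sup>2\<close> makes both terms of the bound of order \<open>1 / (N + 1)\<close>.\<close>
      define b where "b = (real (Suc N))\<^sup>2"
      have "real (Suc N) \<le> b"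
        unfolding b_def by (rule self_le_power) auto
      then have ab: "a < b" "b > 0" using N a by linarith+
      have bnd: "(\<integral>\<^sup>+x. ennreal (cmod (G (Complex x y))) \<partial>lborel) \<le> ennreal (M + pi / (- Im p))" if "a \<le> y" for y
      proof -
        have "(\<integral>\<^sup>+x. ennreal (cmod (G (Complex x y))) \<partial>lborel) \<le> ennreal (M + pi / (y - Im p))"
          using line[of y 1] a that by simp
        also have "\<dots> \<le> ennreal (M + pi / (- Im p))"
          using a that p by (intro ennreal_leI add_left_mono frac_le) auto
        finally show ?thesis .
      qed
      have "(LINT x|lborel. G (Complex x a)) = (LINT x|lborel. G (Complex x b))"
        using horizontal_line_integral_eq[OF G a ab(1) bnd] by auto
      moreover have "ennreal (cmod (LINT x|lborel. G (Complex x b))) \<le> ennreal ((M + pi) / real (Suc N))"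
      proof -
        have "ennreal (cmod (LINT x|lborel. G (Complex x b))) \<le> (\<integral>\<^sup>+x. ennreal (cmod (G (Complex x b))) \<partial>lborel)"
          by (rule integral_norm_bound_ennreal[OF int[OF ab(2)]])
        also have "\<dots> \<le> ennreal (1 / real (Suc N) * M + pi / ((b - Im p) * (1 / real (Suc N))))"
          using line[OF ab(2), of "1 / real (Suc N)"] by simp
        also have "\<dots> \<le> ennreal ((M + pi) / real (Suc N))"
        proof -
          have "real (Suc N) = b * (1 / real (Suc N))"
            by (simp add: b_def power2_eq_square del: of_nat_Suc)
          also have "\<dots> \<le> (b - Im p) * (1 / real (Suc N))"
            using p by (intro mult_right_mono) auto
          finally have "pi / ((b - Im p) * (1 / real (Suc N))) \<le> pi / real (Suc N)"
            by (intro frac_le) auto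
          then show ?thesis by (intro ennreal_leI) (simp add: add_divide_distrib del: of_nat_Suc)
        qed
        finally show ?thesis .
      qed
      ultimately show ?thesis using M(1) by (simp del: of_nat_Suc)
    qed
    have "(\<lambda>N. (M + pi) / real (Suc N)) \<longlonglongrightarrow> 0"
      using LIMSEQ_Suc[OF lim_const_over_n[of "M + pi"]] by simp
    moreover have "eventually (\<lambda>N. cmod (LINT x|lborel. G (Complex x a)) \<le> (M + pi) / real (Suc N)) sequentially"
    proof -
      obtain N0 where "a < real N0" using reals_Archimedean2 by blast
      then show ?thesis
        unfolding eventually_sequentially by (intro exI[of _ N0] allI impI le) auto
    qed
    ultimately have "cmod (LINT x|lborel. G (Complex x a)) \<le> 0"
      by (intro tendsto_lowerbound[of "\<lambda>N. (M + pi) / real (Suc N)" 0 sequentially]) auto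
    then show ?thesis by simp
  qed
  have "(\<lambda>n. LINT x|lborel. F (Complex x (1 / real (Suc n))) * (1 / (Complex x (1 / real (Suc n)) - p)))
     \<longlonglongrightarrow> (LINT x|lborel. F (of_real x) * (1 / (of_real x - p)))"
  proof (rule tendsto_integral_of_L2_bounded[where M = M and g = "\<lambda>x. cmod (1 / (of_real x - p))"])
    show "(\<lambda>x. F (Complex x (1 / real (Suc n)))) \<in> borel_measurable borel" for n
      by (rule holomorphic_line_measurable[OF boundary_hardyD(2)[OF F]]) simp
    show "(\<integral>\<^sup>+x. ennreal ((cmod (F (Complex x (1 / real (Suc n)))))\<^sup>2) \<partial>lborel) \<le> ennreal M" for n
      by (rule M(2)) simp
    show "(\<lambda>n. 1 / (Complex x (1 / real (Suc n)) - p)) \<longlonglongrightarrow> 1 / (of_real x - p)" for x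
      using p by (intro tendsto_intros tendsto_Complex_boundary) auto
    show "cmod (1 / (Complex x (1 / real (Suc n)) - p)) \<le> cmod (1 / (of_real x - p))" for n x
    proof -
      have "(- Im p)\<^sup>2 \<le> (1 / real (Suc n) - Im p)\<^sup>2"
        using p by (intro power_mono) auto
      then have "cmod (of_real x - p) \<le> cmod (Complex x (1 / real (Suc n)) - p)"
        by (simp add: cmod_def del: of_nat_Suc)
      moreover have "cmod (of_real x - p) > 0" using p by auto
      ultimately show ?thesis by (simp add: norm_divide frac_le)
    qed
    show "integrable lborel (\<lambda>x. (cmod (1 / (complex_of_real x - p)))\<^sup>2)"
      by (rule boundary_hardy_square_integrable[OF kernel_boundary_hardy[OF p]])
    show "AE x in lborel. (\<lambda>n. F (Complex x (1 / real (Suc n)))) \<longlonglongrightarrow> F (of_real x)"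
      by (rule boundary_hardyD(4)[OF F])
  qed (use M(1) Fm boundary_hardy_square_integrable[OF F] in auto)
  moreover have "(LINT x|lborel. F (Complex x (1 / real (Suc n))) * (1 / (Complex x (1 / real (Suc n)) - p))) = 0" for n
    using zero[of "1 / real (Suc n)"] by (simp add: G_def del: of_nat_Suc)
  ultimately have "(LINT x|lborel. F (of_real x) * (1 / (of_real x - p))) = 0"
    by (simp add: LIMSEQ_const_iff del: of_nat_Suc)
  then show ?thesis by simp
qed

section \<open>Dividing out zeros of entire functions\<close>

text \<open>For a zero \<open>w\<close> of \<open>n\<close> this is the entire function \<open>n z / (z - w)\<close>; the derivative fills the removable
singularity.\<close>

definition quotient_at :: "(complex \<Rightarrow> complex) \<Rightarrow> complex \<Rightarrow> complex \<Rightarrow> complex" where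
  "quotient_at n w z = (if z = w then deriv n w else n z / (z - w))"

lemma quotient_at_holomorphic:
  assumes "n holomorphic_on UNIV" "n w = 0"
  shows "quotient_at n w holomorphic_on UNIV"
proof -
  have "quotient_at n w = (\<lambda>z. if z = w then deriv n w else (n z - n w) / (z - w))"
    using assms(2) by (auto simp: quotient_at_def fun_eq_iff)
  then show ?thesis using pole_lemma_open[OF assms(1) open_UNIV, of w] by simp
qed

lemma sharp_of_real: "sharp f (of_real x) = cnj (f (of_real x))"
  by (simp add: sharp_def)

lemma has_field_derivative_sharp:
  assumes "(f has_field_derivative D) (at (cnj z))"
  shows "(sharp f has_field_derivative cnj D) (at z)"
  using has_field_derivative_cnj_cnj[OF assms]
  by (simp add: sharp_def[abs_def] o_def)

lemma sharp_holomorphic: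
  assumes "f holomorphic_on UNIV"
  shows "sharp f holomorphic_on UNIV"
proof -
  have "\<exists>D. (sharp f has_field_derivative D) (at z)" for z
    using has_field_derivative_sharp[OF holomorphic_derivI[OF assms open_UNIV UNIV_I]] by blast
  then show ?thesis by (auto simp: holomorphic_on_def field_differentiable_def)
qed

lemma sharp_quotient_at:
  assumes "n holomorphic_on UNIV"
  shows "sharp (quotient_at n a) = quotient_at (sharp n) (cnj a)"
proof
  fix z
  have "deriv (sharp n) (cnj a) = cnj (deriv n a)"
    using has_field_derivative_sharp[OF holomorphic_derivI[OF assms open_UNIV UNIV_I], of "cnj a"]
    by (simp add: DERIV_imp_deriv)
  moreover have "cnj z = a \<longleftrightarrow> z = cnj a" by auto
  ultimately show "sharp (quotient_at n a) z = quotient_at (sharp n) (cnj a) z"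
    by (simp add: sharp_def quotient_at_def)
qed

lemma entire_isCont: "f holomorphic_on UNIV \<Longrightarrow> isCont f z"
  using holomorphic_on_imp_continuous_on continuous_on_eq_continuous_at open_UNIV by blast

lemma entire_measurable:
  assumes "f holomorphic_on UNIV"
  shows "(\<lambda>x::real. f (of_real x)) \<in> borel_measurable borel"
  by (intro borel_measurable_continuous_onI continuous_on_compose2[OF holomorphic_on_imp_continuous_on[OF assms]]
      continuous_intros) auto

section \<open>The de Branges space\<close>

locale hermite_biehler_function =
  fixes E :: "complex \<Rightarrow> complex"
  assumes HB: "E \<in> hermite_biehler"
begin

lemma E_holomorphic: "E holomorphic_on UNIV"
  using HB by (simp add: hermite_biehler_def)

lemma E_cnj_less: "Im z > 0 \<Longrightarrow> cmod (E (cnj z)) < cmod (E z)"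
  using HB by (simp add: hermite_biehler_def upper_half_plane_def)

lemma E_nonzero: "Im z > 0 \<Longrightarrow> E z \<noteq> 0"
  using E_cnj_less[of z] by auto

text \<open>The strict inequality at \<open>\<i>\<close> shows that \<open>E\<close> is not constant, so its zeros are countable.\<close>

lemma AE_E_nonzero: "AE x in lborel. E (of_real x) \<noteq> 0"
proof -
  have "\<not> E constant_on UNIV"
    using E_cnj_less[of \<i>] unfolding constant_on_def by (metis UNIV_I less_irrefl complex_i_not_zero imaginary_unit.sel(2) zero_less_one)
  moreover have "fsigma (UNIV :: complex set)"
    using fsigma.intros[of "\<lambda>_. UNIV :: complex set"] by simp
  ultimately have "countable {z. E z = 0}"
    using holomorphic_countable_zeros[OF E_holomorphic open_UNIV connected_UNIV] by simp
  then have "countable (complex_of_real ` {x. E (of_real x) = 0})"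
    by (rule countable_subset[rotated]) auto
  then have "countable {x. E (complex_of_real x) = 0}"
    by (rule countable_image_inj_on) (simp add: inj_on_def)
  then have "{x. E (complex_of_real x) = 0} \<in> null_sets lborel"
    by (rule countable_imp_null_set_lborel)
  from AE_not_in[OF this] show ?thesis by simp
qed

lemma quotient_boundary_hardy:
  assumes f: "f holomorphic_on UNIV" and H: "(\<lambda>z. f z / E z) \<in> hardy_H2"
  shows "(\<lambda>z. f z / E z) \<in> boundary_hardy"
proof -
  note [measurable] = entire_measurable[OF f] entire_measurable[OF E_holomorphic]
  have "AE x in lborel. (\<lambda>n. f (Complex x (1 / real (Suc n))) / E (Complex x (1 / real (Suc n))))
     \<longlonglongrightarrow> f (of_real x) / E (of_real x)"
    using AE_E_nonzero
  proof eventually_elim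
    case (elim x)
    then show ?case
      using isCont_tendsto_compose[OF entire_isCont[OF f] tendsto_Complex_boundary]
        isCont_tendsto_compose[OF entire_isCont[OF E_holomorphic] tendsto_Complex_boundary]
      by (intro tendsto_divide) auto
  qed
  then show ?thesis using H by (simp add: boundary_hardy_def)
qed

text \<open>Away from \<open>w\<close> the factor \<open>(z - p) / (z - w)\<close> is bounded, and near \<open>w\<close> the quotient itself is bounded by
continuity, hence dominated by a multiple of \<open>1 / (z - p)\<close>. The point \<open>w\<close> may lie on the real line as long as
\<open>E w\<close> does not vanish. The factor \<open>1 / (z - p)\<close> in the hypothesis supplies the decay that makes bounded
numerators, such as that of the reproducing kernel, admissible.\<close>

lemma quotient_at_hardy:
  assumes n: "n holomorphic_on UNIV" "n w = 0" and w: "E w \<noteq> 0" and p: "Im p < 0"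
    and H: "(\<lambda>z. n z / E z * (1 / (z - p))) \<in> hardy_H2"
  shows "(\<lambda>z. quotient_at n w z / E z) \<in> hardy_H2"
proof -
  note q = quotient_at_holomorphic[OF n]
  have "isCont (\<lambda>z. quotient_at n w z / E z) w"
    using w by (intro continuous_intros entire_isCont q E_holomorphic)
  then obtain r where r: "r > 0"
    "\<And>z. dist z w < r \<Longrightarrow> dist (quotient_at n w z / E z) (quotient_at n w w / E w) < 1"
    unfolding continuous_at_eps_delta using zero_less_one by blast
  define B where "B = cmod (quotient_at n w w / E w) + 1"
  have near: "cmod (quotient_at n w z / E z) \<le> B" if "dist z w < r" for z
    using r(2)[OF that] norm_triangle_ineq2[of "quotient_at n w z / E z" "quotient_at n w w / E w"]
    by (simp add: B_def dist_norm)
  have B: "B \<ge> 0" by (simp add: B_def)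
  show ?thesis
  proof (rule hardy_H2_dominated[OF _ H boundary_hardyD(1)[OF kernel_boundary_hardy[OF p]]])
    show "(\<lambda>z. quotient_at n w z / E z) holomorphic_on upper_half_plane"
      by (intro holomorphic_intros holomorphic_on_subset[OF q] holomorphic_on_subset[OF E_holomorphic])
        (auto simp: upper_half_plane_def E_nonzero)
    fix z assume z: "z \<in> upper_half_plane"
    then have zp: "z \<noteq> p" using p by (auto simp: upper_half_plane_def)
    show "(cmod (quotient_at n w z / E z))\<^sup>2 \<le> (1 + cmod (w - p) / r)\<^sup>2 * (cmod (n z / E z * (1 / (z - p))))\<^sup>2
        + (B * (r + cmod (w - p)))\<^sup>2 * (cmod (1 / (z - p)))\<^sup>2"
    proof (cases "dist z w < r")
      case True
      have "cmod (z - p) \<le> r + cmod (w - p)"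
        using norm_triangle_ineq[of "z - w" "w - p"] True by (simp add: dist_norm)
      then have "B * cmod (z - p) \<le> B * (r + cmod (w - p))" using B by (rule mult_left_mono)
      then have "B \<le> (B * (r + cmod (w - p))) * cmod (1 / (z - p))"
        using zp by (simp add: norm_divide field_simps)
      then have "cmod (quotient_at n w z / E z) \<le> (B * (r + cmod (w - p))) * cmod (1 / (z - p))"
        using near[OF True] by linarith
      from power_mono[OF this norm_ge_zero, of 2] show ?thesis
        by (simp add: power_mult_distrib add_increasing)
    next
      case False
      then have zw: "cmod (z - w) \<ge> r" "z \<noteq> w" using r(1) by (auto simp: dist_norm)
      have "cmod (z - p) \<le> cmod (z - w) + cmod (w - p)"
        using norm_triangle_ineq[of "z - w" "w - p"] by simp
      also have "\<dots> \<le> cmod (z - w) + cmod (z - w) * (cmod (w - p) / r)"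
        using mult_right_mono[OF zw(1), of "cmod (w - p) / r"] r(1) by simp
      finally have C: "cmod (z - p) / cmod (z - w) \<le> 1 + cmod (w - p) / r"
        using zw(2) by (simp add: divide_le_eq distrib_left mult.commute)
      have "cmod (quotient_at n w z / E z) = (cmod (z - p) / cmod (z - w)) * cmod (n z / E z * (1 / (z - p)))"
        using zp zw by (simp add: quotient_at_def norm_divide norm_mult)
      also have "\<dots> \<le> (1 + cmod (w - p) / r) * cmod (n z / E z * (1 / (z - p)))"
        using C by (rule mult_right_mono) simp
      finally have "cmod (quotient_at n w z / E z) \<le> (1 + cmod (w - p) / r) * cmod (n z / E z * (1 / (z - p)))" .
      from power_mono[OF this norm_ge_zero, of 2] show ?thesis
        by (simp add: power_mult_distrib add_increasing2)
    qed
  qed auto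
qed

end

text \<open>This form exhibits the inner product as that of the boundary values of \<open>f / E\<close> and \<open>g / E\<close>; at real zeros of \<open>E\<close>
both integrands are \<open>0\<close>.\<close>

lemma dB_inner_eq:
  "dB_inner E f g = (LINT x|lborel. (f (of_real x) / E (of_real x)) * cnj (g (of_real x) / E (of_real x)))"
proof -
  have "f z * cnj (g z) / of_real ((cmod (E z))\<^sup>2) = (f z / E z) * cnj (g z / E z)" for z
    unfolding complex_norm_square by simp
  then show ?thesis by (simp only: dB_inner_def)
qed

lemma dB_inner_cnj: "dB_inner E g f = cnj (dB_inner E f g)"
proof -
  have "cnj (dB_inner E f g)
    = (LINT x|lborel. cnj ((f (of_real x) / E (of_real x)) * cnj (g (of_real x) / E (of_real x))))"
    unfolding dB_inner_eq by (rule Bochner_Integration.integral_cnj[symmetric])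
  also have "\<dots> = dB_inner E g f"
    unfolding dB_inner_eq by (rule Bochner_Integration.integral_cong) (simp_all add: mult.commute)
  finally show ?thesis by simp
qed

lemma dB_norm_square: "dB_inner E f f = of_real ((dB_norm E f)\<^sup>2)"
proof -
  have "dB_inner E f f = (LINT x|lborel. complex_of_real ((cmod (f (of_real x) / E (of_real x)))\<^sup>2))"
    unfolding dB_inner_eq by (simp only: complex_norm_square)
  also have "\<dots> = of_real (LINT x|lborel. (cmod (f (of_real x) / E (of_real x)))\<^sup>2)"
    by (rule integral_complex_of_real)
  finally have "dB_inner E f f = of_real (LINT x|lborel. (cmod (f (of_real x) / E (of_real x)))\<^sup>2)" .
  moreover have "(LINT x|lborel. (cmod (f (of_real x) / E (of_real x)))\<^sup>2) \<ge> 0"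
    by (rule Bochner_Integration.integral_nonneg) simp
  ultimately show ?thesis by (simp add: dB_norm_def)
qed

lemma dB_norm_nonneg: "dB_norm E f \<ge> 0"
proof -
  have "Re (dB_inner E f f) \<ge> 0" by (simp only: dB_norm_square) simp
  then show ?thesis by (simp add: dB_norm_def)
qed

context hermite_biehler_function
begin

lemma dB_spaceD:
  assumes "f \<in> dB_space E"
  shows "f holomorphic_on UNIV" "(\<lambda>z. f z / E z) \<in> boundary_hardy" "(\<lambda>z. sharp f z / E z) \<in> boundary_hardy"
  using assms quotient_boundary_hardy[of f] quotient_boundary_hardy[OF sharp_holomorphic[of f]]
  by (auto simp: dB_space_def)

lemma dB_space_lincomb:
  assumes f: "f \<in> dB_space E" and g: "g \<in> dB_space E"
  shows "(\<lambda>z. a * f z + b * g z) \<in> dB_space E"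
proof -
  have "(\<lambda>z. (a * f z + b * g z) / E z) = (\<lambda>z. a * (f z / E z) + b * (g z / E z))"
    "(\<lambda>z. sharp (\<lambda>z. a * f z + b * g z) z / E z) = (\<lambda>z. cnj a * (sharp f z / E z) + cnj b * (sharp g z / E z))"
    by (simp_all add: sharp_def add_divide_distrib)
  then show ?thesis
    using boundary_hardyD(1)[OF boundary_hardy_lincomb[OF dB_spaceD(2)[OF f] dB_spaceD(2)[OF g]]]
      boundary_hardyD(1)[OF boundary_hardy_lincomb[OF dB_spaceD(3)[OF f] dB_spaceD(3)[OF g]]]
      dB_spaceD(1)[OF f] dB_spaceD(1)[OF g]
    by (simp add: dB_space_def holomorphic_intros)
qed

lemma dB_inner_diff_left:
  assumes f: "f \<in> dB_space E" and g: "g \<in> dB_space E" and h: "h \<in> dB_space E"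
  shows "dB_inner E (\<lambda>z. f z - c * g z) h = dB_inner E f h - c * dB_inner E g h"
proof -
  note i = boundary_hardy_mult_integrable(2)[OF dB_spaceD(2)[OF f] dB_spaceD(2)[OF h]]
    boundary_hardy_mult_integrable(2)[OF dB_spaceD(2)[OF g] dB_spaceD(2)[OF h]]
  have "dB_inner E (\<lambda>z. f z - c * g z) h =
    (LINT x|lborel. (f (of_real x) / E (of_real x)) * cnj (h (of_real x) / E (of_real x))
      - c * ((g (of_real x) / E (of_real x)) * cnj (h (of_real x) / E (of_real x))))"
    unfolding dB_inner_eq by (rule Bochner_Integration.integral_cong) (simp_all add: diff_divide_distrib algebra_simps)
  also have "\<dots> = dB_inner E f h - c * dB_inner E g h"
    unfolding dB_inner_eq
    by (simp only: Bochner_Integration.integral_diff[OF i(1) integrable_mult_right[OF i(2)]] integral_mult_right_zero)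
  finally show ?thesis .
qed

end

section \<open>The reproducing kernel\<close>

definition kernel_numerator :: "(complex \<Rightarrow> complex) \<Rightarrow> complex \<Rightarrow> complex \<Rightarrow> complex" where
  "kernel_numerator E w z = cnj (E w) * E z - E (cnj w) * sharp E z"

text \<open>De Branges' kernel \<open>(cnj (E w) E(z) - cnj (E\<^sup>#(w)) E\<^sup>#(z)) / (2 \<pi> \<i> (cnj w - z))\<close>, where \<open>cnj (E\<^sup>#(w)) = E (cnj w)\<close>. Its only
singularity \<open>z = cnj w\<close> is removable and is filled in by \<open>quotient_at\<close>.\<close>

definition dB_kernel :: "(complex \<Rightarrow> complex) \<Rightarrow> complex \<Rightarrow> complex \<Rightarrow> complex" where
  "dB_kernel E w z = \<i> / (2 * of_real pi) * quotient_at (kernel_numerator E w) (cnj w) z"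

context hermite_biehler_function
begin

lemma kernel_numerator_holomorphic: "kernel_numerator E w holomorphic_on UNIV"
  unfolding kernel_numerator_def[abs_def]
  by (intro holomorphic_intros E_holomorphic sharp_holomorphic)

lemma kernel_numerator_zero: "kernel_numerator E w (cnj w) = 0"
  by (simp add: kernel_numerator_def sharp_def)

lemma dB_kernel_holomorphic: "dB_kernel E w holomorphic_on UNIV"
  unfolding dB_kernel_def[abs_def]
  by (intro holomorphic_intros quotient_at_holomorphic kernel_numerator_holomorphic kernel_numerator_zero)

lemma sharp_dB_kernel: "sharp (dB_kernel E w) = dB_kernel E (cnj w)"
proof -
  have *: "sharp (kernel_numerator E w) = (\<lambda>z. - kernel_numerator E (cnj w) z)"
    by (simp add: sharp_def kernel_numerator_def fun_eq_iff)
  have "quotient_at (\<lambda>z. - kernel_numerator E (cnj w) z) w = (\<lambda>z. - quotient_at (kernel_numerator E (cnj w)) w z)"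
    using kernel_numerator_holomorphic[of "cnj w"]
    by (auto simp: quotient_at_def fun_eq_iff holomorphic_on_def intro!: deriv_minus)
  then have "sharp (quotient_at (kernel_numerator E w) (cnj w)) z = - quotient_at (kernel_numerator E (cnj w)) w z" for z
    using sharp_quotient_at[OF kernel_numerator_holomorphic, of w "cnj w"] * by simp
  then show ?thesis by (simp add: sharp_def dB_kernel_def fun_eq_iff)
qed

text \<open>In the upper half-plane \<open>\<bar>E\<^sup># / E\<bar> \<le> 1\<close>, so the numerator of the kernel divided by \<open>E\<close> is bounded. For \<open>w\<close> in the upper
half-plane the denominator vanishes only at \<open>cnj w\<close>, outside the region, and provides the decay. Otherwise \<open>cnj w\<close>
lies in the closed upper half-plane and is divided out as a zero of the numerator.\<close>

lemma dB_kernel_hardy: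
  assumes w: "E (cnj w) \<noteq> 0 \<or> Im w > 0"
  shows "(\<lambda>z. dB_kernel E w z / E z) \<in> hardy_H2"
proof -
  have bound: "cmod (kernel_numerator E w z / E z) \<le> cmod (E w) + cmod (E (cnj w))"
    if "z \<in> upper_half_plane" for z
  proof -
    have z: "cmod (sharp E z) \<le> cmod (E z)" "E z \<noteq> 0"
      using that E_cnj_less[of z] E_nonzero[of z] by (auto simp: upper_half_plane_def sharp_def)
    have "cmod (kernel_numerator E w z) \<le> cmod (E w) * cmod (E z) + cmod (E (cnj w)) * cmod (sharp E z)"
      unfolding kernel_numerator_def
      using norm_triangle_ineq4[of "cnj (E w) * E z" "E (cnj w) * sharp E z"] by (simp add: norm_mult)
    also have "\<dots> \<le> cmod (E w) * cmod (E z) + cmod (E (cnj w)) * cmod (E z)"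
      using z by (intro add_left_mono mult_left_mono) auto
    finally show ?thesis using z by (simp add: norm_divide divide_le_eq distrib_right)
  qed
  have frac: "(\<lambda>z. kernel_numerator E w z / E z * (1 / (z - p))) \<in> hardy_H2" if p: "Im p < 0" for p
  proof (rule hardy_H2_dominated[OF _ boundary_hardyD(1)[OF kernel_boundary_hardy[OF p]]
        boundary_hardyD(1)[OF kernel_boundary_hardy[OF p]]])
    show "(\<lambda>z. kernel_numerator E w z / E z * (1 / (z - p))) holomorphic_on upper_half_plane"
      using p by (intro holomorphic_intros holomorphic_on_subset[OF kernel_numerator_holomorphic]
          holomorphic_on_subset[OF E_holomorphic]) (auto simp: upper_half_plane_def E_nonzero)
    show "(cmod (kernel_numerator E w z / E z * (1 / (z - p))))\<^sup>2
      \<le> (cmod (E w) + cmod (E (cnj w)))\<^sup>2 * (cmod (1 / (z - p)))\<^sup>2 + 0 * (cmod (1 / (z - p)))\<^sup>2"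
      if "z \<in> upper_half_plane" for z
      using power_mono[OF bound[OF that] norm_ge_zero, of 2]
      by (simp only: norm_mult power_mult_distrib mult_zero_left add_0_right) (rule mult_right_mono, simp_all)
  qed auto
  have "(\<lambda>z. quotient_at (kernel_numerator E w) (cnj w) z / E z) \<in> hardy_H2"
  proof (cases "Im w > 0")
    case True
    have cong: "quotient_at (kernel_numerator E w) (cnj w) z / E z = kernel_numerator E w z / E z * (1 / (z - cnj w))"
      if "z \<in> upper_half_plane" for z
      using that True by (auto simp: quotient_at_def upper_half_plane_def)
    have hol: "(\<lambda>z. quotient_at (kernel_numerator E w) (cnj w) z / E z) holomorphic_on upper_half_plane"
      by (intro holomorphic_intros holomorphic_on_subset[OF quotient_at_holomorphic[OF kernel_numerator_holomorphic kernel_numerator_zero]]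
          holomorphic_on_subset[OF E_holomorphic]) (auto simp: upper_half_plane_def E_nonzero)
    have p: "Im (cnj w) < 0" using True by simp
    show ?thesis
      by (rule hardy_H2_dominated[OF hol frac[OF p] frac[OF p], where A = 1 and B = 0]) (simp_all add: cong)
  next
    case False
    then show ?thesis
      using quotient_at_hardy[OF kernel_numerator_holomorphic kernel_numerator_zero _ _ frac[of "-\<i>"], of ] w
      by simp
  qed
  then have "(\<lambda>z. quotient_at (kernel_numerator E w) (cnj w) z / E z) \<in> boundary_hardy"
    by (rule quotient_boundary_hardy[OF quotient_at_holomorphic[OF kernel_numerator_holomorphic kernel_numerator_zero]])
  from boundary_hardyD(1)[OF boundary_hardy_lincomb[OF this this, of "\<i> / (2 * of_real pi)" 0]]
  show ?thesis by (simp add: dB_kernel_def)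
qed

lemma dB_kernel_in_dB_space:
  assumes "Im w = 0 \<longrightarrow> E w \<noteq> 0"
  shows "dB_kernel E w \<in> dB_space E"
proof -
  have 1: "E (cnj w) \<noteq> 0 \<or> Im w > 0" 
  proof (cases "Im w = 0")
    case True
    then have "cnj w = w" by (simp add: complex_eq_iff)
    then show ?thesis using assms True by simp
  next
    case False
    then show ?thesis using E_nonzero[of "cnj w"] by (auto simp: neq_iff)
  qed
  have 2: "E (cnj (cnj w)) \<noteq> 0 \<or> Im (cnj w) > 0"
    using assms E_nonzero[of w] by (cases "Im w = 0") (auto simp: neq_iff)
  show ?thesis
    using dB_kernel_holomorphic[of w] dB_kernel_hardy[OF 1] dB_kernel_hardy[OF 2]
    by (simp add: dB_space_def sharp_dB_kernel)
qed

text \<open>The numerator is chosen to vanish at \<open>w\<close>, so the quotient is entire. The right-hand side is \<open>E w\<close> times the Cauchy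
integrand of \<open>f / E\<close> at \<open>w\<close>, regularised by an explicit rational term.\<close>

lemma quotient_at_partial_fraction:
  fixes f :: "complex \<Rightarrow> complex"
  assumes "X \<noteq> w" "X \<noteq> p" "E X \<noteq> 0"
  shows "quotient_at (\<lambda>z. (z - p) * f z * E w - (w - p) * f w * E z) w X / E X / (X - p)
    = E w * (f X / E X) / (X - w) - f w * ((w - p) / ((X - p) * (X - w)))"
proof -
  have aux: "(q * u * e - c * v * a) / d / a / q = e * (u / a) / d - v * (c / (q * d))"
    if "d \<noteq> 0" "q \<noteq> 0" "a \<noteq> 0" for a c d e q u v :: complex
    using that by (simp add: field_simps)
  show ?thesis
    using assms aux[of "X - w" "X - p" "E X" "f X" "E w" "w - p" "f w"] by (simp add: quotient_at_def)
qed

lemma zero_divided_boundary_hardy: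
  assumes f: "f holomorphic_on UNIV" and H: "(\<lambda>z. f z / E z) \<in> boundary_hardy"
    and w: "E w \<noteq> 0" and p: "Im p < 0"
  defines "G \<equiv> (\<lambda>z. quotient_at (\<lambda>z. (z - p) * f z * E w - (w - p) * f w * E z) w z / E z)"
  shows "G \<in> boundary_hardy"
proof -
  let ?n = "\<lambda>z. (z - p) * f z * E w - (w - p) * f w * E z"
  have n: "?n holomorphic_on UNIV" "?n w = 0"
    by (intro holomorphic_intros f E_holomorphic) simp
  have L: "(\<lambda>z. E w * (f z / E z) + (- (w - p) * f w) * (1 / (z - p))) \<in> hardy_H2"
    by (intro boundary_hardyD(1) boundary_hardy_lincomb H kernel_boundary_hardy p)
  have "(\<lambda>z. ?n z / E z * (1 / (z - p))) \<in> hardy_H2"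
  proof (rule hardy_H2_dominated[OF _ L L, where A = 1 and B = 0])
    show "(\<lambda>z. ?n z / E z * (1 / (z - p))) holomorphic_on upper_half_plane"
      using p by (intro holomorphic_intros holomorphic_on_subset[OF f]
          holomorphic_on_subset[OF E_holomorphic]) (auto simp: upper_half_plane_def E_nonzero)
    fix z assume "z \<in> upper_half_plane"
    then have "E z \<noteq> 0" "z \<noteq> p" using p E_nonzero by (auto simp: upper_half_plane_def)
    then have "?n z / E z * (1 / (z - p)) = E w * (f z / E z) + (- (w - p) * f w) * (1 / (z - p))"
      by (simp add: field_simps)
    then show "(cmod (?n z / E z * (1 / (z - p))))\<^sup>2
      \<le> 1 * (cmod (E w * (f z / E z) + (- (w - p) * f w) * (1 / (z - p))))\<^sup>2 + 0 * (cmod (E w * (f z / E z) + (- (w - p) * f w) * (1 / (z - p))))\<^sup>2"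
      by simp
  qed auto
  from quotient_boundary_hardy[OF quotient_at_holomorphic[OF n] quotient_at_hardy[OF n w p this]]
  show ?thesis unfolding G_def .
qed

text \<open>The common end of the reproducing formula for real and nonreal \<open>w\<close>: the Hardy class terms integrate to \<open>0\<close>,
and the rational term is \<open>2 \<i> Im p / \<bar>x - p\<bar>\<^sup>2\<close>, where \<open>1 / \<bar>x - p\<bar>\<^sup>2\<close> has integral \<open>\<pi> / \<bar>Im p\<bar>\<close>.\<close>

lemma kernel_integrand_integral:
  assumes G: "G \<in> boundary_hardy" and H: "H \<in> boundary_hardy" and p: "Im p < 0"
    and eq: "AE x in lborel. F x = 1 / (2 * of_real pi * \<i>) * (G (of_real x) / (of_real x - p)
       - b * cnj (H (of_real x) / (of_real x - p)) - v * ((p - cnj p) / ((of_real x - p) * (of_real x - cnj p))))"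
    and m: "F \<in> borel_measurable borel"
  shows "integral\<^sup>L lborel F = v"
proof -
  have i: "integrable lborel (\<lambda>x. K (of_real x) / (of_real x - p))" if "K \<in> boundary_hardy" for K
    using boundary_hardy_mult_integrable(1)[OF that kernel_boundary_hardy[OF p]] by simp
  have ic: "integrable lborel (\<lambda>x. cnj (H (of_real x) / (of_real x - p)))"
    using i[OF H] by (rule integrable_cnj)
  have zc: "(LINT x|lborel. cnj (H (of_real x) / (of_real x - p))) = 0"
    using integral_mult_kernel_eq_0[OF H p] by (subst Bochner_Integration.integral_cnj) simp
  have k: "has_bochner_integral lborel (\<lambda>x. complex_of_real (1 / (cmod (of_real x - p))\<^sup>2)) (of_real (pi / \<bar>Im p\<bar>))"
    using has_bochner_integral_inverse_norm_square[of p] p by (intro has_bochner_integral_of_real) simp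
  have keq: "(p - cnj p) / ((of_real x - p) * (of_real x - cnj p))
      = (p - cnj p) * complex_of_real (1 / (cmod (of_real x - p))\<^sup>2)" for x :: real
  proof -
    have "complex_of_real ((cmod (of_real x - p))\<^sup>2) = (of_real x - p) * (of_real x - cnj p)"
      by (subst complex_norm_square) simp
    then show ?thesis unfolding of_real_divide by simp
  qed
  define R where "R = (\<lambda>x::real. v * ((p - cnj p) / ((of_real x - p) * (of_real x - cnj p))))"
  have "(p - cnj p) * of_real (pi / \<bar>Im p\<bar>) = - (2 * of_real pi * \<i>)"
    using p by (simp add: complex_diff_cnj)
  then have "has_bochner_integral lborel R (v * (- (2 * of_real pi * \<i>)))"
    unfolding R_def keq
    using has_bochner_integral_mult_right[OF has_bochner_integral_mult_right[OF k, of "p - cnj p"], of v]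
    by simp
  then have R: "integrable lborel R" "integral\<^sup>L lborel R = v * (- (2 * of_real pi * \<i>))"
    by (simp_all add: has_bochner_integral_iff)
  note d1 = Bochner_Integration.integrable_diff[OF i[OF G] integrable_mult_right[OF ic, of b]]
  note d2 = Bochner_Integration.integrable_diff[OF d1 R(1)]
  have "integral\<^sup>L lborel F = (LINT x|lborel. 1 / (2 * of_real pi * \<i>) * (G (of_real x) / (of_real x - p)
       - b * cnj (H (of_real x) / (of_real x - p)) - R x))"
    by (rule integral_cong_AE) (use m eq borel_measurable_integrable[OF integrable_mult_right[OF d2]] in \<open>simp_all only: R_def measurable_lborel2\<close>)
  also have "\<dots> = 1 / (2 * of_real pi * \<i>) * ((LINT x|lborel. G (of_real x) / (of_real x - p))
       - b * (LINT x|lborel. cnj (H (of_real x) / (of_real x - p))) - integral\<^sup>L lborel R)"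
    by (simp only: integral_mult_right_zero Bochner_Integration.integral_diff[OF d1 R(1)]
        Bochner_Integration.integral_diff[OF i[OF G] integrable_mult_right[OF ic]])
  also have "\<dots> = v"
    using zc integral_mult_kernel_eq_0[OF G p] R(2) by simp
  finally show ?thesis .
qed

text \<open>On the real line the integrand is a multiple of \<open>(E(w) F(x) - E\<^sup>#(w) cnj (F'(x))) / (x - w)\<close> with \<open>F = f / E\<close> and
\<open>F' = f\<^sup># / E\<close>. If \<open>w\<close> is real, both terms are singular at \<open>w\<close> and a zero is divided out of each, with any \<open>p\<close> in the
lower half-plane. If \<open>Im w > 0\<close>, this is done for \<open>F\<close> only, with \<open>p = cnj w\<close>: the conjugate of \<open>1 / (x - w)\<close> is
\<open>1 / (x - p)\<close>, so the second term is, up to a constant, the conjugate of \<open>F'(x) / (x - p)\<close>, whose integral is \<open>0\<close>.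
In both cases the values at \<open>w\<close> combine to \<open>f w\<close>.\<close>

theorem dB_kernel_reproducing:
  assumes f: "f \<in> dB_space E" and w: "Im w \<ge> 0" "E w \<noteq> 0"
  shows "dB_inner E f (dB_kernel E w) = f w"
proof -
  note fh = dB_spaceD(1)[OF f]
  note F = dB_spaceD(2)[OF f] and F' = dB_spaceD(3)[OF f]
  define I where "I x = (f (of_real x) / E (of_real x)) * cnj (dB_kernel E w (of_real x) / E (of_real x))" for x :: real
  have I: "I x = 1 / (2 * of_real pi * \<i>) * (E w * (f (of_real x) / E (of_real x)) / (of_real x - w)
      - sharp E w * cnj (sharp f (of_real x) / E (of_real x)) / (of_real x - w))"
    if x: "of_real x \<noteq> w" "E (of_real x) \<noteq> 0" for x :: real
  proof -
    define e where "e = E (of_real x)"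
    have xw: "of_real x \<noteq> cnj w" using x(1) by (metis complex_cnj_complex_of_real complex_cnj_cnj)
    have "cnj (quotient_at (kernel_numerator E w) (cnj w) (of_real x)) = (E w * cnj e - sharp E w * e) / (of_real x - w)"
      using xw by (simp add: quotient_at_def kernel_numerator_def sharp_def e_def)
    moreover have "cnj (\<i> / (2 * of_real pi)) = 1 / (2 * of_real pi * \<i>)"
      by (simp add: complex_eq_iff Re_divide Im_divide)
    ultimately have k: "cnj (dB_kernel E w (of_real x)) = 1 / (2 * of_real pi * \<i>) * ((E w * cnj e - sharp E w * e) / (of_real x - w))"
      by (simp only: dB_kernel_def complex_cnj_mult)
    have alg: "(u / a) * (c * ((v * a' - v' * a) / d) / a') = c * (v * (u / a) / d - v' * (u / a') / d)"
      if "a \<noteq> 0" "a' \<noteq> 0" "d \<noteq> 0" for u c v v' a a' d :: complex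
      using that by (simp add: field_simps)
    show ?thesis
      unfolding I_def sharp_of_real e_def[symmetric] complex_cnj_divide complex_cnj_cnj k
      by (rule alg) (use x in \<open>simp_all add: e_def\<close>)
  qed
  have AEx: "AE x in lborel. of_real x \<noteq> w \<and> E (of_real x) \<noteq> 0"
  proof -
    have "AE x in lborel. x \<noteq> Re w" by (rule AE_lborel_singleton)
    then show ?thesis using AE_E_nonzero by eventually_elim auto
  qed
  have I_meas: "I \<in> borel_measurable borel"
  proof -
    have [measurable]: "(\<lambda>x::real. cnj (dB_kernel E w (of_real x) / E (of_real x))) \<in> borel_measurable borel"
      by (rule measurable_compose[OF borel_measurable_divide[OF entire_measurable[OF dB_kernel_holomorphic] entire_measurable[OF E_holomorphic]]])
        (intro borel_measurable_continuous_onI continuous_intros)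
    show ?thesis unfolding I_def[abs_def] using boundary_hardyD(3)[OF F] by measurable
  qed
  have pf: "(w - p) / ((X - p) * (X - w)) - (w - q) / ((X - q) * (X - w)) = - ((p - q) / ((X - p) * (X - q)))"
    if "X \<noteq> w" "X \<noteq> p" "X \<noteq> q" for X p q :: complex
    using that by (simp add: divide_simps) (simp add: algebra_simps)
  have "integral\<^sup>L lborel I = f w"
  proof (cases "Im w = 0")
    case True
    then have cw: "cnj w = w" by (simp add: complex_eq_iff)
    define p where "p = w - \<i>"
    have p: "Im p < 0" using True by (simp add: p_def)
    note G = zero_divided_boundary_hardy[OF fh F w(2) p]
    note H = zero_divided_boundary_hardy[OF sharp_holomorphic[OF fh] F' w(2) p]
    show ?thesis
    proof (rule kernel_integrand_integral[OF G H p _ I_meas, where b = 1])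
      show "AE x in lborel. I x = 1 / (2 * of_real pi * \<i>) *
        (quotient_at (\<lambda>z. (z - p) * f z * E w - (w - p) * f w * E z) w (of_real x) / E (of_real x) / (of_real x - p)
         - 1 * cnj (quotient_at (\<lambda>z. (z - p) * sharp f z * E w - (w - p) * sharp f w * E z) w (of_real x) / E (of_real x) / (of_real x - p))
         - f w * ((p - cnj p) / ((of_real x - p) * (of_real x - cnj p))))"
        using AEx
      proof eventually_elim
        case (elim x)
        have xp: "of_real x \<noteq> p" "of_real x \<noteq> cnj p" using p by (auto simp: complex_eq_iff)
        have s: "sharp E w = cnj (E w)" "cnj (sharp f w) = f w" by (simp_all add: sharp_def cw)
        have cnj_partial_fraction: "cnj (E w * (u / E (of_real x)) / (of_real x - w) - sharp f w * ((w - p) / ((of_real x - p) * (of_real x - w))))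
            = sharp E w * cnj (u / E (of_real x)) / (of_real x - w) - f w * ((w - cnj p) / ((of_real x - cnj p) * (of_real x - w)))" for u
          using s cw by simp
        have collect: "c * (a - b) = c * (a - u * \<alpha> - 1 * (b - u * \<beta>) - u * \<gamma>)" if "\<alpha> - \<beta> = - \<gamma>"
          for a b c u \<alpha> \<beta> \<gamma> :: complex
        proof -
          have "\<gamma> = \<beta> - \<alpha>" using that by (simp add: algebra_simps)
          show ?thesis unfolding \<open>\<gamma> = \<beta> - \<alpha>\<close> by (simp add: algebra_simps)
        qed
        show ?case
          unfolding I[OF conjunct1[OF elim] conjunct2[OF elim]]
            quotient_at_partial_fraction[OF conjunct1[OF elim] xp(1) conjunct2[OF elim]]
          cnj_partial_fraction
          by (rule collect) (use pf[OF conjunct1[OF elim] xp] in \<open>simp add: algebra_simps\<close>)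
      qed
    qed
  next
    case False
    then have v: "Im w > 0" using w(1) by simp
    define p where "p = cnj w"
    have p: "Im p < 0" "cnj p = w" using v by (simp_all add: p_def)
    note G = zero_divided_boundary_hardy[OF fh F w(2) p(1)]
    show ?thesis
    proof (rule kernel_integrand_integral[OF G F' p(1) _ I_meas, where b = "sharp E w"])
      show "AE x in lborel. I x = 1 / (2 * of_real pi * \<i>) *
        (quotient_at (\<lambda>z. (z - p) * f z * E w - (w - p) * f w * E z) w (of_real x) / E (of_real x) / (of_real x - p)
         - sharp E w * cnj (sharp f (of_real x) / E (of_real x) / (of_real x - p))
         - f w * ((p - cnj p) / ((of_real x - p) * (of_real x - cnj p))))"
        using AEx
      proof eventually_elim
        case (elim x)
        have xp: "of_real x \<noteq> p" using p by (auto simp: complex_eq_iff)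
        have m: "(p - w) / D = - ((w - p) / D)" for D
          by (metis minus_diff_eq minus_divide_left)
        have cn: "cnj (u / E (of_real x) / (of_real x - p)) = cnj (u / E (of_real x)) / (of_real x - w)" for u
          by (simp add: p(2))
        show ?case
          unfolding I[OF conjunct1[OF elim] conjunct2[OF elim]]
            quotient_at_partial_fraction[OF conjunct1[OF elim] xp conjunct2[OF elim]] p(2)
            m cn by (simp add: algebra_simps)
      qed
    qed
  qed
  then show ?thesis unfolding dB_inner_eq I_def[abs_def] .
qed

end

section \<open>Kernel norms and the quotient\<close>

lemma dB_kernel_diagonal_nonreal:
  assumes "Im w \<noteq> 0"
  shows "dB_kernel E w w = ((cmod (E w))\<^sup>2 - (cmod (E (cnj w)))\<^sup>2) / (4 * pi * Im w)"
proof -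
  have d: "w - cnj w = 2 * \<i> * of_real (Im w)" by (simp add: complex_diff_cnj)
  have "w \<noteq> cnj w" using assms by (auto simp: complex_eq_iff)
  moreover have "kernel_numerator E w w = of_real ((cmod (E w))\<^sup>2) - of_real ((cmod (E (cnj w)))\<^sup>2)"
    unfolding complex_norm_square by (simp add: kernel_numerator_def sharp_def mult.commute)
  ultimately show ?thesis
    unfolding dB_kernel_def quotient_at_def d using assms by (simp add: field_simps)
qed

context hermite_biehler_function
begin

lemma dB_kernel_diagonal_real:
  assumes "Im w = 0"
  shows "dB_kernel E w w = of_real (- Im (deriv E w * cnj (E w)) / pi)"
proof -
  have w: "cnj w = w" using assms by (simp add: complex_eq_iff)
  have dE: "(E has_field_derivative deriv E z) (at z)" for z
    by (rule holomorphic_derivI[OF E_holomorphic open_UNIV UNIV_I])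
  have "(sharp E has_field_derivative cnj (deriv E w)) (at w)"
    using has_field_derivative_sharp[of E "deriv E w" w] dE[of w] by (simp add: w)
  then have "(kernel_numerator E w has_field_derivative cnj (E w) * deriv E w - E w * cnj (deriv E w)) (at w)"
    unfolding kernel_numerator_def[abs_def] w by (auto intro!: derivative_eq_intros dE)
  then have "deriv (kernel_numerator E w) w = cnj (E w) * deriv E w - E w * cnj (deriv E w)"
    by (rule DERIV_imp_deriv)
  also have "\<dots> = 2 * \<i> * of_real (Im (deriv E w * cnj (E w)))"
    by (simp add: complex_eq_iff)
  finally show ?thesis by (simp add: dB_kernel_def quotient_at_def w)
qed

text \<open>The reproducing property for \<open>f = K\<^sub>w\<close>. For \<open>w\<close> in the lower half-plane it is transported from \<open>cnj w\<close> by the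
antiunitary symmetry \<open>f \<mapsto> f\<^sup>#\<close>, which maps \<open>K\<^sub>w\<close> to the kernel at \<open>cnj w\<close>.\<close>

lemma dB_kernel_diagonal_eq_norm:
  assumes "Im w = 0 \<longrightarrow> E w \<noteq> 0"
  shows "dB_kernel E w w = of_real ((dB_norm E (dB_kernel E w))\<^sup>2)"
proof (cases "Im w \<ge> 0")
  case True
  then have "E w \<noteq> 0" using assms E_nonzero[of w] by (cases "Im w = 0") auto
  from dB_kernel_reproducing[OF dB_kernel_in_dB_space[OF assms] True this]
  show ?thesis by (simp only: dB_norm_square)
next
  case False
  then have w: "Im (cnj w) \<ge> 0" "E (cnj w) \<noteq> 0" using E_nonzero[of "cnj w"] by auto
  have "dB_inner E (dB_kernel E w) (dB_kernel E w) = dB_inner E (dB_kernel E (cnj w)) (dB_kernel E (cnj w))"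
    unfolding sharp_dB_kernel[of w, symmetric] dB_inner_def sharp_of_real by (simp add: mult.commute)
  also have "\<dots> = dB_kernel E (cnj w) (cnj w)"
    by (rule dB_kernel_reproducing[OF dB_kernel_in_dB_space w]) (use w in auto)
  also have "\<dots> = cnj (dB_kernel E w w)"
    unfolding sharp_dB_kernel[of w, symmetric] by (simp add: sharp_def)
  finally show ?thesis unfolding dB_norm_square by (metis complex_cnj_cnj complex_cnj_complex_of_real)
qed

text \<open>The Pythagorean theorem: what is subtracted from \<open>f\<close> is its orthogonal projection onto the kernel at \<open>s\<close>,
because the difference vanishes at \<open>s\<close>.\<close>

lemma dB_norm_sub_projection:
  assumes f: "f \<in> dB_space E" and s: "E (of_real s) \<noteq> 0"
    and k: "\<kappa> = (dB_norm E (dB_kernel E (of_real s)))\<^sup>2" "\<kappa> \<noteq> 0"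
  shows "(dB_norm E (\<lambda>z. f z - f (of_real s) / of_real \<kappa> * dB_kernel E (of_real s) z))\<^sup>2
    = (dB_norm E f)\<^sup>2 - (cmod (f (of_real s)))\<^sup>2 / \<kappa>"
proof -
  define K where "K = dB_kernel E (of_real s)"
  define c where "c = f (of_real s) / of_real \<kappa>"
  define g where "g = (\<lambda>z. f z - c * K z)"
  have K: "K \<in> dB_space E" unfolding K_def by (rule dB_kernel_in_dB_space) (use s in auto)
  have repr: "dB_inner E h K = h (of_real s)" if "h \<in> dB_space E" for h
    unfolding K_def by (rule dB_kernel_reproducing[OF that]) (use s in auto)
  have KK: "K (of_real s) = of_real \<kappa>"
    unfolding K_def k(1) by (rule dB_kernel_diagonal_eq_norm) (use s in auto)
  have g: "g \<in> dB_space E"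
    using dB_space_lincomb[OF f K, of 1 "- c"] by (simp add: g_def)
  have "g (of_real s) = 0" using k(2) by (simp add: g_def KK c_def)
  then have "dB_inner E K g = 0" using repr[OF g] dB_inner_cnj[of E K g] by simp
  then have "dB_inner E g g = dB_inner E f g"
    using dB_inner_diff_left[OF f K g, of c] by (simp add: g_def)
  also have "\<dots> = cnj (dB_inner E g f)" by (rule dB_inner_cnj)
  also have "dB_inner E g f = dB_inner E f f - c * dB_inner E K f"
    using dB_inner_diff_left[OF f K f, of c] by (simp add: g_def)
  also have "dB_inner E K f = cnj (f (of_real s))"
    using dB_inner_cnj[of E K f] repr[OF f] by simp
  also have "cnj (dB_inner E f f - c * cnj (f (of_real s)))
      = of_real ((dB_norm E f)\<^sup>2 - (cmod (f (of_real s)))\<^sup>2 / \<kappa>)"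
  proof -
    have "c * cnj (f (of_real s)) = of_real ((cmod (f (of_real s)))\<^sup>2 / \<kappa>)"
      unfolding c_def of_real_divide complex_norm_square by simp
    then show ?thesis unfolding dB_norm_square by simp
  qed
  finally show ?thesis
    unfolding dB_norm_square of_real_eq_iff by (simp add: g_def c_def K_def)
qed

text \<open>At a real zero of \<open>A\<close> the value of \<open>E\<close> is purely imaginary, so at two such points the two terms of the
numerator cancel.\<close>

lemma dB_kernel_orthogonal:
  assumes "A_part E (of_real s) = 0" "A_part E (of_real u) = 0" "s \<noteq> u"
  shows "dB_kernel E (of_real s) (of_real u) = 0"
proof -
  have c: "cnj (E (of_real r)) = - E (of_real r)" if "A_part E (of_real r) = 0" for r :: real
    using that by (simp add: A_part_def sharp_of_real eq_neg_iff_add_eq_0 add.commute)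
  show ?thesis
    using assms(3) c[OF assms(1)] c[OF assms(2)]
    by (simp add: dB_kernel_def quotient_at_def kernel_numerator_def sharp_of_real)
qed

text \<open>Induction on the set: removing from \<open>f\<close> its projection onto one kernel does not change its values at the
other points, by orthogonality, and lowers the squared norm by exactly the corresponding term. A kernel of
norm \<open>0\<close> contributes the term \<open>0\<close>.\<close>

lemma bessel_inequality_zeros:
  assumes "finite S" and "\<And>s. s \<in> S \<Longrightarrow> E (of_real s) \<noteq> 0 \<and> A_part E (of_real s) = 0"
    and "f \<in> dB_space E"
  shows "(\<Sum>s\<in>S. (cmod (f (of_real s)))\<^sup>2 / (dB_norm E (dB_kernel E (of_real s)))\<^sup>2) \<le> (dB_norm E f)\<^sup>2"
  using assms
proof (induction S arbitrary: f rule: finite_induct)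
  case empty
  then show ?case by simp
next
  case (insert s S)
  define \<kappa> where "\<kappa> = (dB_norm E (dB_kernel E (of_real s)))\<^sup>2"
  define g where "g = (\<lambda>z. f z - f (of_real s) / of_real \<kappa> * dB_kernel E (of_real s) z)"
  show ?case
  proof (cases "\<kappa> = 0")
    case True
    then show ?thesis using insert by (simp add: \<kappa>_def)
  next
    case False
    have K: "dB_kernel E (of_real s) \<in> dB_space E"
      by (rule dB_kernel_in_dB_space) (use insert.prems(1)[of s] in auto)
    have g: "g \<in> dB_space E"
      using dB_space_lincomb[OF insert.prems(2) K, of 1 "- (f (of_real s) / of_real \<kappa>)"] by (simp add: g_def)
    have gf: "g (of_real u) = f (of_real u)" if "u \<in> S" for u
      using that insert.hyps(2) insert.prems(1) dB_kernel_orthogonal[of s u] by (auto simp: g_def)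
    have "(\<Sum>u\<in>S. (cmod (f (of_real u)))\<^sup>2 / (dB_norm E (dB_kernel E (of_real u)))\<^sup>2)
        = (\<Sum>u\<in>S. (cmod (g (of_real u)))\<^sup>2 / (dB_norm E (dB_kernel E (of_real u)))\<^sup>2)"
      by (rule sum.cong) (simp_all add: gf)
    also have "\<dots> \<le> (dB_norm E g)\<^sup>2"
      using insert.IH[OF _ g] insert.prems(1) by simp
    also have "\<dots> = (dB_norm E f)\<^sup>2 - (cmod (f (of_real s)))\<^sup>2 / \<kappa>"
      unfolding g_def by (rule dB_norm_sub_projection) (use insert.prems False in \<open>auto simp: \<kappa>_def\<close>)
    finally show ?thesis using insert.hyps by (simp add: \<kappa>_def)
  qed
qed

text \<open>With \<open>E s\<close> purely imaginary, the diagonal value at \<open>s\<close> becomes \<open>- \<i> E(s) Re (E'(s)) / \<pi>\<close>, which is the common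
denominator of both cases of the quotient up to the constants of the two diagonal formulas. If this value is \<open>0\<close>,
both sides are \<open>0\<close> by the convention for division.\<close>

lemma Q_quotient_eq_kernel_ratio:
  assumes "A_part E (of_real s) = 0"
  shows "Q_quotient E \<phi> s = dB_kernel E (\<phi> (of_real s)) (\<phi> (of_real s)) / dB_kernel E (of_real s) (of_real s)"
proof -
  define w where "w = \<phi> (of_real s)"
  define e where "e = E (of_real s)"
  define D where "D = Re (deriv E (of_real s))"
  have "cnj e = - e"
    using assms by (simp add: A_part_def sharp_of_real e_def eq_neg_iff_add_eq_0 add.commute)
  then have e: "e = \<i> * of_real (Im e)" "cnj e = - (\<i> * of_real (Im e))"
    by (auto simp: complex_eq_iff)
  have "Im (deriv E (of_real s) * cnj e) = - (Im e * D)"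
    unfolding e(2) by (simp add: D_def)
  then have den: "dB_kernel E (of_real s) (of_real s) = of_real (Im e * D / pi)"
    using dB_kernel_diagonal_real[of "of_real s"] by (simp add: e_def)
  have r: "w \<in> \<real> \<longleftrightarrow> Im w = 0" by (simp add: complex_is_Real_iff)
  show ?thesis
  proof (cases "Im w = 0")
    case True
    then have "Q_quotient E \<phi> s = - \<i> * of_real (Im (deriv E w * cnj (E w))) / (e * of_real D)"
      by (simp add: Q_quotient_def Let_def r w_def[symmetric] e_def D_def)
    also have "\<dots> = of_real (- Im (deriv E w * cnj (E w)) / pi) / of_real (Im e * D / pi)"
      by (subst e(1)) (simp add: divide_simps)
    finally show ?thesis
      unfolding den w_def[symmetric] dB_kernel_diagonal_real[OF True] .
  next
    case False
    then have "Q_quotient E \<phi> s = of_real ((cmod (E w))\<^sup>2 - (cmod (E (cnj w)))\<^sup>2)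
        / (- 4 * \<i> * of_real (Im w) * e * of_real D)"
      by (simp add: Q_quotient_def Let_def r w_def[symmetric] e_def D_def)
    also have "\<dots> = of_real (((cmod (E w))\<^sup>2 - (cmod (E (cnj w)))\<^sup>2) / (4 * pi * Im w)) / of_real (Im e * D / pi)"
      using False by (subst e(1)) (simp add: divide_simps)
    finally show ?thesis
      unfolding den w_def[symmetric] using dB_kernel_diagonal_nonreal[OF False, of E] by simp
  qed
qed

end

section \<open>Absence of compactness\<close>

theorem theorem4p4:
  fixes \<phi> E :: "complex \<Rightarrow> complex" and t :: "nat \<Rightarrow> real" and d :: real
  assumes "\<phi> holomorphic_on UNIV"
    and "E holomorphic_on UNIV"
    and "E \<in> hermite_biehler"
    and "bij_betw (\<lambda>n. complex_of_real (t n)) UNIV {z. A_part E z = 0}"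
    and "\<And>n. E (complex_of_real (t n)) \<noteq> 0"
    and "dB_bounded_operator E (composition_operator \<phi>)"
    and "d > 0"
    and "ereal d \<le> limsup (\<lambda>n. ereal (Re (Q_quotient E \<phi> (t n))))"
  shows "\<not> dB_compact_operator E (composition_operator \<phi>)"
proof
  assume compact: "dB_compact_operator E (composition_operator \<phi>)"
  interpret hermite_biehler_function E by standard (rule assms(3))
  define k where "k w = dB_norm E (dB_kernel E w)" for w
  have zero: "A_part E (of_real (t n)) = 0" for n
    using bij_betwE[OF assms(4)] by blast
  have injt: "inj t"
    using bij_betw_imp_inj_on[OF assms(4)] by (auto simp: inj_on_def)
  have kt: "dB_kernel E (of_real (t n)) (of_real (t n)) = of_real ((k (of_real (t n)))\<^sup>2)" for n
    unfolding k_def by (rule dB_kernel_diagonal_eq_norm) (use assms(5) in auto)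
  have inf: "infinite {n. d / 2 < Re (Q_quotient E \<phi> (t n))}"
  proof
    assume "finite {n. d / 2 < Re (Q_quotient E \<phi> (t n))}"
    then have "eventually (\<lambda>n. \<not> d / 2 < Re (Q_quotient E \<phi> (t n))) sequentially"
      unfolding cofinite_eq_sequentially[symmetric] eventually_cofinite by simp
    then have "eventually (\<lambda>n. ereal (Re (Q_quotient E \<phi> (t n))) \<le> ereal (d / 2)) sequentially"
      by eventually_elim simp
    then have "limsup (\<lambda>n. ereal (Re (Q_quotient E \<phi> (t n)))) \<le> ereal (d / 2)"
      by (rule Limsup_bounded)
    with assms(8) have "ereal d \<le> ereal (d / 2)" by (rule order_trans)
    then show False using assms(7) by simp
  qed
  obtain s where s: "strict_mono (s :: nat \<Rightarrow> nat)" "\<And>n. d / 2 < Re (Q_quotient E \<phi> (t (s n)))"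
    using infinite_enumerate[OF inf] by auto
  define \<tau> where "\<tau> n = t (s n)" for n
  define w where "w n = \<phi> (of_real (\<tau> n))" for n
  have Q: "d / 2 < Re (dB_kernel E (w n) (w n) / of_real ((k (of_real (\<tau> n)))\<^sup>2))" for n
    using s(2)[of n] unfolding Q_quotient_eq_kernel_ratio[OF zero] kt \<tau>_def w_def .
  \<comment> \<open>A real zero \<open>w\<close> of \<open>E\<close> makes the quotient vanish; hence the kernel at \<open>w n\<close> belongs to the space.\<close>
  have wE: "Im (w n) = 0 \<longrightarrow> E (w n) \<noteq> 0" for n
  proof
    assume "Im (w n) = 0"
    from dB_kernel_diagonal_real[OF this] show "E (w n) \<noteq> 0"
      using Q[of n] assms(7) by auto
  qed
  have kw: "dB_kernel E (w n) (w n) = of_real ((k (w n))\<^sup>2)" for n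
    unfolding k_def by (rule dB_kernel_diagonal_eq_norm[OF wE])
  have kge: "k z \<ge> 0" for z by (simp add: k_def dB_norm_nonneg)
  have ratio: "d / 2 < (k (w n) / k (of_real (\<tau> n)))\<^sup>2" for n
    using Q[of n] unfolding kw by (simp add: power_divide flip: of_real_power of_real_divide)
  have pos: "k (w n) > 0" "k (of_real (\<tau> n)) > 0" for n
  proof -
    have "k (w n) \<noteq> 0 \<and> k (of_real (\<tau> n)) \<noteq> 0" using ratio[of n] assms(7) by auto
    then show "k (w n) > 0" "k (of_real (\<tau> n)) > 0" using kge[of "w n"] kge[of "of_real (\<tau> n)"] by auto
  qed
  have K: "dB_kernel E (w n) \<in> dB_space E" for n by (rule dB_kernel_in_dB_space[OF wE])
  \<comment> \<open>The normalised kernels; their images have size at least \<open>sqrt (d / 2)\<close> at \<open>\<tau> n\<close>, relative to the kernel there.\<close>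
  define f where "f n = (\<lambda>z. of_real (1 / k (w n)) * dB_kernel E (w n) z)" for n
  have f: "f n \<in> dB_space E" for n
    using dB_space_lincomb[OF K[of n] K[of n], of "of_real (1 / k (w n))" 0] by (simp add: f_def)
  have fnorm: "dB_norm E (f n) \<le> 1" for n
  proof -
    have "dB_norm E (f n) = (1 / k (w n)) * k (w n)"
    proof -
      have "dB_inner E (f n) (f n) = of_real ((1 / k (w n))\<^sup>2) * dB_inner E (dB_kernel E (w n)) (dB_kernel E (w n))"
        unfolding dB_inner_eq f_def
        by (subst integral_mult_right_zero[symmetric]) (simp add: power2_eq_square mult_ac)
      also have "\<dots> = of_real (((1 / k (w n)) * k (w n))\<^sup>2)"
        unfolding dB_norm_square k_def by (simp only: of_real_mult[symmetric] power_mult_distrib)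
      finally have "(dB_norm E (f n))\<^sup>2 = ((1 / k (w n)) * k (w n))\<^sup>2"
        unfolding dB_norm_square of_real_eq_iff .
      then show ?thesis
        by (rule power2_eq_imp_eq) (use pos(1)[of n] dB_norm_nonneg in auto)
    qed
    then show ?thesis using pos(1)[of n] by simp
  qed
  obtain r g where r: "strict_mono (r :: nat \<Rightarrow> nat)" and g: "g \<in> dB_space E"
    and lim: "(\<lambda>n. dB_norm E (\<lambda>z. composition_operator \<phi> (f (r n)) z - g z)) \<longlonglongrightarrow> 0"
    using compact f fnorm unfolding dB_compact_operator_def by meson
  have Tf: "composition_operator \<phi> (f n) \<in> dB_space E" for n
    using compact f unfolding dB_compact_operator_def dB_linear_operator_def by blast
  \<comment> \<open>Bessel's inequality for a single point is the norm estimate for evaluation at it.\<close>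
  have point: "cmod (h (of_real (\<tau> n))) / k (of_real (\<tau> n)) \<le> dB_norm E h" if "h \<in> dB_space E" for h n
  proof -
    have "(cmod (h (of_real (\<tau> n))) / k (of_real (\<tau> n)))\<^sup>2 \<le> (dB_norm E h)\<^sup>2"
      using bessel_inequality_zeros[of "{\<tau> n}" h] that assms(5) zero by (simp add: \<tau>_def k_def power_divide)
    then show ?thesis by (rule power2_le_imp_le) (rule dB_norm_nonneg)
  qed
  have "summable (\<lambda>n. (cmod (g (of_real (\<tau> n))) / k (of_real (\<tau> n)))\<^sup>2)"
  proof (rule bounded_imp_summable)
    fix n
    have inj\<tau>: "inj \<tau>" unfolding \<tau>_def
      using inj_compose[OF injt strict_mono_imp_inj_on[OF s(1)]] by (simp add: o_def)
    have "(\<Sum>i\<le>n. (cmod (g (of_real (\<tau> i))) / k (of_real (\<tau> i)))\<^sup>2)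
      = (\<Sum>u\<in>\<tau> ` {..n}. (cmod (g (of_real u)))\<^sup>2 / (dB_norm E (dB_kernel E (of_real u)))\<^sup>2)"
      by (subst sum.reindex) (use inj\<tau> in \<open>auto simp: k_def power_divide intro: inj_on_subset\<close>)
    also have "\<dots> \<le> (dB_norm E g)\<^sup>2"
      by (rule bessel_inequality_zeros[OF _ _ g]) (use assms(5) zero in \<open>auto simp: \<tau>_def\<close>)
    finally show "(\<Sum>i\<le>n. (cmod (g (of_real (\<tau> i))) / k (of_real (\<tau> i)))\<^sup>2) \<le> (dB_norm E g)\<^sup>2" .
  qed simp
  from summable_LIMSEQ_zero[OF this]
  have "(\<lambda>n. cmod (g (of_real (\<tau> n))) / k (of_real (\<tau> n))) \<longlonglongrightarrow> 0"
    by (simp add: power_tendsto_0_iff)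
  then have "(\<lambda>n. cmod (g (of_real (\<tau> (r n)))) / k (of_real (\<tau> (r n)))) \<longlonglongrightarrow> 0"
    using LIMSEQ_subseq_LIMSEQ[OF _ r] by (force simp: o_def)
  from tendsto_add[OF lim this]
  have lim0: "(\<lambda>n. dB_norm E (\<lambda>z. composition_operator \<phi> (f (r n)) z - g z)
      + cmod (g (of_real (\<tau> (r n)))) / k (of_real (\<tau> (r n)))) \<longlonglongrightarrow> 0" by simp
  have "sqrt (d / 2) \<le> dB_norm E (\<lambda>z. composition_operator \<phi> (f (r n)) z - g z)
      + cmod (g (of_real (\<tau> (r n)))) / k (of_real (\<tau> (r n)))" for n
  proof -
    define h where "h = (\<lambda>z. composition_operator \<phi> (f (r n)) z - g z)"
    have h: "h \<in> dB_space E"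
      using dB_space_lincomb[OF Tf[of "r n"] g, of 1 "-1"] by (simp add: h_def)
    define \<sigma> where "\<sigma> = \<tau> (r n)"
    have val: "composition_operator \<phi> (f (r n)) (of_real \<sigma>) = of_real (k (w (r n)))"
    proof -
      have "composition_operator \<phi> (f (r n)) (of_real \<sigma>) = f (r n) (w (r n))"
        by (simp add: composition_operator_def w_def \<sigma>_def)
      also have "\<dots> = of_real (k (w (r n)))"
        unfolding f_def kw using pos(1)[of "r n"] by (simp add: power2_eq_square)
      finally show ?thesis .
    qed
    have "sqrt (d / 2) \<le> k (w (r n)) / k (of_real \<sigma>)"
      using ratio[of "r n"] pos[of "r n"] unfolding \<sigma>_def by (intro real_le_lsqrt) auto
    also have "\<dots> = cmod (h (of_real \<sigma>) + g (of_real \<sigma>)) / k (of_real \<sigma>)"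
      using pos(1)[of "r n"] by (simp add: h_def val)
    also have "\<dots> \<le> (cmod (h (of_real \<sigma>)) + cmod (g (of_real \<sigma>))) / k (of_real \<sigma>)"
      by (intro divide_right_mono norm_triangle_ineq kge)
    also have "\<dots> \<le> dB_norm E h + cmod (g (of_real \<sigma>)) / k (of_real \<sigma>)"
      using point[OF h, of "r n"] by (simp add: add_divide_distrib \<sigma>_def)
    finally show ?thesis by (simp add: h_def \<sigma>_def)
  qed
  then have "sqrt (d / 2) \<le> 0"
    by (intro tendsto_lowerbound[OF lim0]) auto
  then show False using assms(7) by simp
qed

end
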